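(* Let $d,N\ge 1$, let $E,G\in\mathbb{R}^{d\times d}$ be invertible, $t\in(0,1)$, $\mathbf{x}_0\in\mathbb{R}^d$, and let $\mathbf{x}_1,\dots,\mathbf{x}_N\in\mathbb{R}^d$ be center points. Assume that all diagonal entries of $G^{-1}E^TE$ are nonzero and that the matrix $W_1$ (the left $N\times N$ block of the infinite Vandermonde matrix $W=(\mathbf{v}_k^{\boldsymbol{\ell}})$, see the context) is invertible. For $k=1,\dots,N$ set $$\omega_k=\sum_{i=1}^N(W_1^{-1})_{ki}^2>0\quad\text{and}\quad \mathbf{y}_k=\mathrm{Diag}\,\mathbf{v}_k\in\mathbb{R}^d.$$ For $j_{\max}\in\mathbb{N}$ with $M=\binom{j_{\max}+d}{d}\ge N$ denote $$\mathrm{const}_{j_{\max}}:=\left(\sum_{k=1}^N\frac{\omega_k\,\mathbf{k}!\,(t/2)^{|\mathbf{k}|-(j_{\max}+1)}}{\mathbf{d}_{\mathrm{vec}}^{2\mathbf{k}}\,(j_{\max}+1)!}\right)\cdot\left(\sum_{i=1}^N\exp\left(\frac{2}{t}\|\mathbf{y}_i\|_2^2\right)\|\mathbf{y}_i\|_2^{2(j_{\max}+1)}\right),$$ where $\mathbf{k}\in\mathbb{N}^d$ denotes the $k$-th multi-index in the basis enumeration. Then the truncation error $\delta\Psi=\Psi-\hat\Psi$ satisfies, for all $\mathbf{x}\in\mathbb{R}^d$, $$\|\delta\Psi(\mathbf{x})\|_2^2\ \le\ \mathrm{const}_{j_{\max}}\cdot\left(H_{\mathrm{lim}}^{G,E,t}(\mathbf{x}-\mathbf{x}_0)-\sum_{|\boldsymbol{\ell}|\le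 j_{\max}}H_{\boldsymbol{\ell}}^{G,E,t}(\mathbf{x}-\mathbf{x}_0)^2\right),$$ where $H_{\mathrm{lim}}^{G,E,t}(\mathbf{x})=\sum_{\boldsymbol{\ell}\in\mathbb{N}^d}H_{\boldsymbol{\ell}}^{G,E,t}(\mathbf{x})^2$ can be evaluated via $$H_{\mathrm{lim}}^{G,E,t}(\mathbf{x})=\frac{\exp\left(-2\mathbf{x}^TE^TE\mathbf{x}+\frac{2t\|G^T\mathbf{x}\|_2^2}{1+t}\right)}{(1-t^2)^{d/2}}.$$
   Context: Multi-indices: $\mathbb{N}=\{0,1,2,\dots\}$; for $\boldsymbol{\ell}\in\mathbb{N}^d$, $\mathbf{y}\in\mathbb{R}^d$: $|\boldsymbol{\ell}|=\sum_i\ell_i$, $\boldsymbol{\ell}!=\prod_i\ell_i!$, $\mathbf{y}^{\boldsymbol{\ell}}=\prod_iy_i^{\ell_i}$ (with $0^0=1$). A fixed enumeration of $\mathbb{N}^d$ by non-decreasing total degree $|\boldsymbol{\ell}|$ is used, so that the first $M=\binom{j_{\max}+d}{d}$ multi-indices are exactly those with $|\boldsymbol{\ell}|\le j_{\max}$; the $k$-th multi-index ($k=1,2,\dots$) is denoted by the bold letter $\mathbf{k}$. Infinite vectors and matrices are indexed via this enumeration. Hermite functions: $h_{\ell+1}(x)=2xh_\ell(x)-2\ell h_{\ell-1}(x)$, $h_0=1$, $h_{-1}=0$; $h_{\boldsymbol{\ell}}(\mathbf{x})=\prod_ih_{\ell_i}(x_i)$; $$H_{\boldsymbol{\ell}}^{G,E,t}(\mathbf{x})=\frac{t^{|\boldsymbol{\ell}|/2}}{\sqrt{2^{|\boldsymbol{\ell}|}\boldsymbol{\ell}!}}h_{\boldsymbol{\ell}}(G^T\mathbf{x})\exp(-\mathbf{x}^TE^TE\mathbf{x}).$$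 $H^{G,E,t}(\mathbf{x})$ is the infinite row vector of all $H_{\boldsymbol{\ell}}^{G,E,t}(\mathbf{x})$, and $\hat H^{G,E,t}(\mathbf{x})\in\mathbb{R}^{1\times M}$ consists of its first $M$ entries. Matrices: write $G^{-1}E^TE=\mathrm{Diag}+\mathrm{Rem}$, with $\mathrm{Diag}$ the diagonal part and $\mathrm{Rem}$ the off-diagonal part; $\mathbf{d}_{\mathrm{vec}}\in\mathbb{R}^d$ is the vector of diagonal entries of $\mathrm{Diag}$. Set $\boldsymbol{\Delta}_k=\mathbf{x}_k-\mathbf{x}_0$, $\mathbf{v}_k=(\mathrm{Id}+\mathrm{Diag}^{-1}\mathrm{Rem})\boldsymbol{\Delta}_k$, $\tilde G=E^TEG^{-T}G^{-1}E^TE$. Let $\bar E$ be the $N\times N$ diagonal matrix with $\bar E_{kk}=\exp(-\boldsymbol{\Delta}_k^TE^TE\boldsymbol{\Delta}_k+\boldsymbol{\Delta}_k^T\tilde G\boldsymbol{\Delta}_k)$, let $W$ be the $N\times\infty$ matrix with entries $W_{k\boldsymbol{\ell}}=\mathbf{v}_k^{\boldsymbol{\ell}}$, and let $D$ be the infinite diagonal matrix with entries $D_{\boldsymbol{\ell}\boldsymbol{\ell}}=\mathbf{d}_{\mathrm{vec}}^{\boldsymbol{\ell}}\sqrt{2^{|\boldsymbol{\ell}|}}/\sqrt{t^{|\boldsymbol{\ell}|}\boldsymbol{\ell}!}$. Block-decompose $W=(W_1\ \ W_2)$ with $W_1\in\mathbb{R}^{N\times N}$ (first $N$ columns), and $D=\begin{pmatrix}D_1&0\\0&D_2\end{pmatrix}$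 with $D_1\in\mathbb{R}^{N\times N}$. Let $\hat W_2\in\mathbb{R}^{N\times(M-N)}$ be the first $M-N$ columns of $W_2$ and $\hat D_2\in\mathbb{R}^{(M-N)\times(M-N)}$ the leading block of $D_2$. Stable basis: with $\Phi(\mathbf{x})=(\phi_1(\mathbf{x}),\dots,\phi_N(\mathbf{x}))$, $\phi_k(\mathbf{x})=\exp(-(\mathbf{x}-\mathbf{x}_k)^TE^TE(\mathbf{x}-\mathbf{x}_k))$, one has $\Phi(\mathbf{x})^T=\bar E\,W D\,H^{G,E,t}(\mathbf{x}-\mathbf{x}_0)^T$. The stable basis is the row vector $\Psi(\mathbf{x})$ with $N$ components given by $$\Psi(\mathbf{x})^T=(\bar EW_1D_1)^{-1}\Phi(\mathbf{x})^T=\begin{pmatrix}\mathrm{Id}&D_1^{-1}W_1^{-1}W_2D_2\end{pmatrix}H^{G,E,t}(\mathbf{x}-\mathbf{x}_0)^T,$$ and its truncation is $$\hat\Psi(\mathbf{x})^T=\begin{pmatrix}\mathrm{Id}_{N\times N}&D_1^{-1}W_1^{-1}\hat W_2\hat D_2\end{pmatrix}\hat H^{G,E,t}(\mathbf{x}-\mathbf{x}_0)^T.$$ *)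

theory Defs
  imports "Jordan_Normal_Form.Gauss_Jordan_Elimination" "HOL-Analysis.Analysis"
begin

text \<open>
  Vectors and matrices over the fixed space dimension \<open>d = CARD('d)\<close> are those of
  HOL-Analysis, whereas the matrices whose sizes \<open>N\<close> and \<open>M\<close> are natural numbers are
  those of Jordan_Normal_Form, with 0-based indices.  Below, \<open>$\<close> and \<open>\<bullet>\<close> always
  denote the HOL-Analysis operations.
\<close>

no_notation Matrix.vec_index (infixl "$" 100)
no_notation Matrix.scalar_prod (infix "\<bullet>" 70)


subsection \<open>Multi-indices\<close>

type_synonym 'd multi_index = "nat ^ 'd"

definition mi_deg :: "('d::finite) multi_index \<Rightarrow> nat" where
  "mi_deg l = (\<Sum>i\<in>UNIV. l $ i)"

definition mi_fact :: "('d::finite) multi_index \<Rightarrow> real" where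
  "mi_fact l = (\<Prod>i\<in>UNIV. fact (l $ i))"

definition mi_power :: "real ^ 'd \<Rightarrow> ('d::finite) multi_index \<Rightarrow> real" where
  "mi_power y l = (\<Prod>i\<in>UNIV. (y $ i) ^ (l $ i))"

text \<open>
  The enumeration is 0-based: \<open>e k\<close> is the \<open>(k+1)\<close>-st multi-index.
\<close>

definition graded_enumeration :: "(nat \<Rightarrow> ('d::finite) multi_index) \<Rightarrow> bool" where
  "graded_enumeration e \<longleftrightarrow> bij e \<and> mono (\<lambda>k. mi_deg (e k))"


subsection \<open>Hermite functions\<close>

text \<open>
  The second equation is the three-term recurrence at \<open>l = 0\<close> with \<open>h\<^sub>-\<^sub>1 = 0\<close>.
\<close>

fun hermite :: "nat \<Rightarrow> real \<Rightarrow> real" where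
  "hermite 0 x = 1"
| "hermite (Suc 0) x = 2 * x * hermite 0 x"
| "hermite (Suc (Suc l)) x = 2 * x * hermite (Suc l) x - 2 * real (Suc l) * hermite l x"

definition hermite_mi :: "('d::finite) multi_index \<Rightarrow> real ^ 'd \<Rightarrow> real" where
  "hermite_mi l x = (\<Prod>i\<in>UNIV. hermite (l $ i) (x $ i))"

definition H_basis ::
  "real ^ 'd ^ 'd \<Rightarrow> real ^ 'd ^ 'd \<Rightarrow> real \<Rightarrow> ('d::finite) multi_index \<Rightarrow> real ^ 'd \<Rightarrow> real" where
  "H_basis G E t l x =
     t powr (real (mi_deg l) / 2) / sqrt (2 ^ mi_deg l * mi_fact l)
       * hermite_mi l (Finite_Cartesian_Product.transpose G *v x)
       * exp (- (x \<bullet> ((Finite_Cartesian_Product.transpose E ** E) *v x)))"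

definition H_lim :: "real ^ 'd ^ 'd \<Rightarrow> real ^ 'd ^ 'd \<Rightarrow> real \<Rightarrow> real ^ ('d::finite) \<Rightarrow> real" where
  "H_lim G E t x = (\<Sum>\<^sub>\<infinity>l\<in>UNIV. (H_basis G E t l x)\<^sup>2)"


subsection \<open>Matrices over the space dimension\<close>

definition GE_mat :: "real ^ 'd ^ 'd \<Rightarrow> real ^ 'd ^ 'd \<Rightarrow> real ^ 'd ^ ('d::finite)" where
  "GE_mat G E = matrix_inv G ** Finite_Cartesian_Product.transpose E ** E"

definition Diag :: "real ^ 'd ^ 'd \<Rightarrow> real ^ 'd ^ 'd \<Rightarrow> real ^ 'd ^ ('d::finite)" where
  "Diag G E = (\<chi> i j. if i = j then GE_mat G E $ i $ j else 0)"

definition Rem :: "real ^ 'd ^ 'd \<Rightarrow> real ^ 'd ^ 'd \<Rightarrow> real ^ 'd ^ ('d::finite)" where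
  "Rem G E = (\<chi> i j. if i = j then 0 else GE_mat G E $ i $ j)"

definition d_vec :: "real ^ 'd ^ 'd \<Rightarrow> real ^ 'd ^ 'd \<Rightarrow> real ^ ('d::finite)" where
  "d_vec G E = (\<chi> i. Diag G E $ i $ i)"

definition G_tilde :: "real ^ 'd ^ 'd \<Rightarrow> real ^ 'd ^ 'd \<Rightarrow> real ^ 'd ^ ('d::finite)" where
  "G_tilde G E =
     Finite_Cartesian_Product.transpose E ** E
       ** Finite_Cartesian_Product.transpose (matrix_inv G) ** matrix_inv G
       ** Finite_Cartesian_Product.transpose E ** E"

text \<open>
  The vectors belonging to a single centre \<open>xc\<close>.
\<close>

definition v_vec ::
  "real ^ 'd ^ 'd \<Rightarrow> real ^ 'd ^ 'd \<Rightarrow> real ^ 'd \<Rightarrow> real ^ 'd \<Rightarrow> real ^ ('d::finite)" where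
  "v_vec G E x0 xc =
     (Finite_Cartesian_Product.mat 1 + matrix_inv (Diag G E) ** Rem G E) *v (xc - x0)"

definition y_vec ::
  "real ^ 'd ^ 'd \<Rightarrow> real ^ 'd ^ 'd \<Rightarrow> real ^ 'd \<Rightarrow> real ^ 'd \<Rightarrow> real ^ ('d::finite)" where
  "y_vec G E x0 xc = Diag G E *v v_vec G E x0 xc"


subsection \<open>The factors of the kernel translates\<close>

text \<open>
  The centres \<open>x\<^sub>1, \<dots>, x\<^sub>N\<close> are \<open>xs 0, \<dots>, xs (N - 1)\<close>.  The matrices with infinitely
  many rows or columns are given by their entries.
\<close>

definition E_bar ::
  "real ^ 'd ^ 'd \<Rightarrow> real ^ 'd ^ 'd \<Rightarrow> real ^ 'd \<Rightarrow> (nat \<Rightarrow> real ^ ('d::finite)) \<Rightarrow> nat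
     \<Rightarrow> real Matrix.mat" where
  "E_bar G E x0 xs N =
     mat_diag N (\<lambda>k. let \<Delta> = xs k - x0 in
       exp (- (\<Delta> \<bullet> ((Finite_Cartesian_Product.transpose E ** E) *v \<Delta>))
            + \<Delta> \<bullet> (G_tilde G E *v \<Delta>)))"

definition W_entry ::
  "(nat \<Rightarrow> 'd multi_index) \<Rightarrow> real ^ 'd ^ 'd \<Rightarrow> real ^ 'd ^ 'd \<Rightarrow> real ^ 'd
     \<Rightarrow> (nat \<Rightarrow> real ^ ('d::finite)) \<Rightarrow> nat \<Rightarrow> nat \<Rightarrow> real" where
  "W_entry e G E x0 xs k l = mi_power (v_vec G E x0 (xs k)) (e l)"

definition D_entry ::
  "(nat \<Rightarrow> ('d::finite) multi_index) \<Rightarrow> real ^ 'd ^ 'd \<Rightarrow> real ^ 'd ^ 'd \<Rightarrow> real \<Rightarrow> nat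
     \<Rightarrow> real" where
  "D_entry e G E t l =
     mi_power (d_vec G E) (e l) * sqrt (2 ^ mi_deg (e l))
       / sqrt (t ^ mi_deg (e l) * mi_fact (e l))"

definition W1 ::
  "(nat \<Rightarrow> 'd multi_index) \<Rightarrow> real ^ 'd ^ 'd \<Rightarrow> real ^ 'd ^ 'd \<Rightarrow> real ^ 'd
     \<Rightarrow> (nat \<Rightarrow> real ^ ('d::finite)) \<Rightarrow> nat \<Rightarrow> real Matrix.mat" where
  "W1 e G E x0 xs N = Matrix.mat N N (\<lambda>(k, l). W_entry e G E x0 xs k l)"

definition W2_hat ::
  "(nat \<Rightarrow> 'd multi_index) \<Rightarrow> real ^ 'd ^ 'd \<Rightarrow> real ^ 'd ^ 'd \<Rightarrow> real ^ 'd
     \<Rightarrow> (nat \<Rightarrow> real ^ ('d::finite)) \<Rightarrow> nat \<Rightarrow> nat \<Rightarrow> real Matrix.mat" where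
  "W2_hat e G E x0 xs N M = Matrix.mat N (M - N) (\<lambda>(k, l). W_entry e G E x0 xs k (N + l))"

definition D1 ::
  "(nat \<Rightarrow> ('d::finite) multi_index) \<Rightarrow> real ^ 'd ^ 'd \<Rightarrow> real ^ 'd ^ 'd \<Rightarrow> real \<Rightarrow> nat
     \<Rightarrow> real Matrix.mat" where
  "D1 e G E t N = mat_diag N (D_entry e G E t)"

definition D2_hat ::
  "(nat \<Rightarrow> ('d::finite) multi_index) \<Rightarrow> real ^ 'd ^ 'd \<Rightarrow> real ^ 'd ^ 'd \<Rightarrow> real \<Rightarrow> nat \<Rightarrow> nat
     \<Rightarrow> real Matrix.mat" where
  "D2_hat e G E t N M = mat_diag (M - N) (\<lambda>l. D_entry e G E t (N + l))"

text \<open>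
  \<open>mat_inv\<close> is meaningful for invertible square matrices only; otherwise it is unspecified.
\<close>

definition mat_inv :: "real Matrix.mat \<Rightarrow> real Matrix.mat" where
  "mat_inv A = the (mat_inverse A)"


subsection \<open>The stable basis and its truncation\<close>

definition Phi ::
  "real ^ 'd ^ 'd \<Rightarrow> (nat \<Rightarrow> real ^ ('d::finite)) \<Rightarrow> nat \<Rightarrow> real ^ 'd \<Rightarrow> real Matrix.vec" where
  "Phi E xs N x =
     Matrix.vec N (\<lambda>k.
       exp (- ((x - xs k) \<bullet> ((Finite_Cartesian_Product.transpose E ** E) *v (x - xs k)))))"

definition Psi ::
  "(nat \<Rightarrow> 'd multi_index) \<Rightarrow> real ^ 'd ^ 'd \<Rightarrow> real ^ 'd ^ 'd \<Rightarrow> real \<Rightarrow> real ^ 'd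
     \<Rightarrow> (nat \<Rightarrow> real ^ ('d::finite)) \<Rightarrow> nat \<Rightarrow> real ^ 'd \<Rightarrow> real Matrix.vec" where
  "Psi e G E t x0 xs N x =
     mat_inv (E_bar G E x0 xs N * W1 e G E x0 xs N * D1 e G E t N) *\<^sub>v Phi E xs N x"

definition H_hat ::
  "(nat \<Rightarrow> ('d::finite) multi_index) \<Rightarrow> real ^ 'd ^ 'd \<Rightarrow> real ^ 'd ^ 'd \<Rightarrow> real \<Rightarrow> nat
     \<Rightarrow> real ^ 'd \<Rightarrow> real Matrix.vec" where
  "H_hat e G E t M x = Matrix.vec M (\<lambda>l. H_basis G E t (e l) x)"

text \<open>
  The block row \<open>(Id  B)\<close> is a four-block matrix whose lower blocks have no rows.
\<close>

definition Psi_hat ::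
  "(nat \<Rightarrow> 'd multi_index) \<Rightarrow> real ^ 'd ^ 'd \<Rightarrow> real ^ 'd ^ 'd \<Rightarrow> real \<Rightarrow> real ^ 'd
     \<Rightarrow> (nat \<Rightarrow> real ^ ('d::finite)) \<Rightarrow> nat \<Rightarrow> nat \<Rightarrow> real ^ 'd \<Rightarrow> real Matrix.vec" where
  "Psi_hat e G E t x0 xs N M x =
     four_block_mat
       (1\<^sub>m N)
       (mat_inv (D1 e G E t N) * mat_inv (W1 e G E x0 xs N)
          * W2_hat e G E x0 xs N M * D2_hat e G E t N M)
       (0\<^sub>m 0 N) (0\<^sub>m 0 (M - N))
     *\<^sub>v H_hat e G E t M (x - x0)"

definition delta_Psi ::
  "(nat \<Rightarrow> 'd multi_index) \<Rightarrow> real ^ 'd ^ 'd \<Rightarrow> real ^ 'd ^ 'd \<Rightarrow> real \<Rightarrow> real ^ 'd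
     \<Rightarrow> (nat \<Rightarrow> real ^ ('d::finite)) \<Rightarrow> nat \<Rightarrow> nat \<Rightarrow> real ^ 'd \<Rightarrow> real Matrix.vec" where
  "delta_Psi e G E t x0 xs N M x =
     Psi e G E t x0 xs N x - Psi_hat e G E t x0 xs N M x"

definition norm2_vec :: "real Matrix.vec \<Rightarrow> real" where
  "norm2_vec a = sqrt (\<Sum>k<dim_vec a. (vec_index a k)\<^sup>2)"


subsection \<open>The constant of the error bound\<close>

definition omega ::
  "(nat \<Rightarrow> 'd multi_index) \<Rightarrow> real ^ 'd ^ 'd \<Rightarrow> real ^ 'd ^ 'd \<Rightarrow> real ^ 'd
     \<Rightarrow> (nat \<Rightarrow> real ^ ('d::finite)) \<Rightarrow> nat \<Rightarrow> nat \<Rightarrow> real" where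
  "omega e G E x0 xs N k = (\<Sum>i<N. (mat_inv (W1 e G E x0 xs N) $$ (k, i))\<^sup>2)"

text \<open>
  The exponent of \<open>t / 2\<close> may be negative, hence the integer power.
\<close>

definition const_err ::
  "(nat \<Rightarrow> 'd multi_index) \<Rightarrow> real ^ 'd ^ 'd \<Rightarrow> real ^ 'd ^ 'd \<Rightarrow> real \<Rightarrow> real ^ 'd
     \<Rightarrow> (nat \<Rightarrow> real ^ ('d::finite)) \<Rightarrow> nat \<Rightarrow> nat \<Rightarrow> real" where
  "const_err e G E t x0 xs N j =
     (\<Sum>k<N. omega e G E x0 xs N k * mi_fact (e k)
                * (t / 2) powi (int (mi_deg (e k)) - int (j + 1))
              / (mi_power (d_vec G E) (2 *s e k) * fact (j + 1)))
     * (\<Sum>i<N. exp (2 / t * (norm (y_vec G E x0 (xs i)))\<^sup>2)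
                 * norm (y_vec G E x0 (xs i)) ^ (2 * (j + 1)))"

end

theory Submission
  imports Defs
begin

text \<open>
  Write \<open>A = E\<^sup>T E\<close>, \<open>z = x - x0\<close>, and for the \<open>i\<close>-th centre \<open>\<Delta> = x\<^sub>i - x0\<close> and
  \<open>y\<^sub>i = G\<^sup>-\<^sup>1 A \<Delta>\<close>, which is the vector \<open>Diag v\<^sub>i\<close>.  The generating function of the Hermite
  polynomials, \<open>\<Sum>\<^sub>n h\<^sub>n(w) s\<^sup>n / n! = exp (2ws - s\<^sup>2)\<close>, taken in every coordinate, expands the kernel
  translate at \<open>x\<^sub>i\<close>, up to the factor on the diagonal of \<open>E_bar\<close>, as \<open>\<Sum>\<^sub>l W\<^sub>i\<^sub>l D\<^sub>l H\<^sub>l(z)\<close> (lemma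
  \<open>kernel_expansion\<close>).  Inverting \<open>E_bar W\<^sub>1 D\<^sub>1\<close> turns these expansions into those of the stable
  basis.  The truncated basis is the same expression with every series cut after its first \<open>M\<close>
  terms, because \<open>W\<^sub>1\<^sup>-\<^sup>1 W\<^sub>1\<close> produces the identity block.  With \<open>V = W\<^sub>1\<^sup>-\<^sup>1\<close> the error is therefore
  \<open>\<delta>\<Psi>\<^sub>k = D\<^sub>k\<^sup>-\<^sup>1 \<Sum>\<^sub>i V\<^sub>k\<^sub>i T\<^sub>i\<close>, where \<open>T\<^sub>i\<close> is the part of \<open>\<Sum>\<^sub>l W\<^sub>i\<^sub>l D\<^sub>l H\<^sub>l(z)\<close> with \<open>l \<ge> M\<close>, counting
  indices from zero (lemma \<open>delta_Psi_entry\<close>).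
  
  The Cauchy-Schwarz inequality is then used twice.  In the sum over \<open>i\<close> it produces
  \<open>\<omega>\<^sub>k \<Sum>\<^sub>i T\<^sub>i\<^sup>2\<close>; in \<open>T\<^sub>i\<close> it separates the tail of \<open>\<Sum>\<^sub>l H\<^sub>l(z)\<^sup>2\<close>, which is the last factor of the
  bound, from the tail of \<open>\<Sum>\<^sub>l (W\<^sub>i\<^sub>l D\<^sub>l)\<^sup>2\<close>.  By the multinomial theorem the latter is the
  exponential tail of \<open>\<Sum>\<^sub>n s\<^sup>n / n!\<close> over \<open>n > j\<close> at \<open>s = (2/t) |y\<^sub>i|\<^sup>2\<close>, hence at most
  \<open>exp s s\<^sup>j\<^sup>+\<^sup>1 / (j+1)!\<close> (lemma \<open>W_D_tail\<close>).  Collecting the powers of \<open>t/2\<close> gives the stated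
  constant.  Tails over the index and over the degree agree because there are exactly \<open>M\<close>
  multi-indices of degree at most \<open>j\<close>.
  
  The closed form of the full series is the product over the coordinates of Mehler's formula on
  the diagonal, \<open>\<Sum>\<^sub>n h\<^sub>n(x)\<^sup>2 t\<^sup>n / (2\<^sup>n n!) = exp (2tx\<^sup>2 / (1+t)) / sqrt (1 - t\<^sup>2)\<close>.  Both
  one-dimensional formulas are obtained in the same way: the three-term recurrence becomes a linear
  first-order differential equation for the power series, and its solution is determined by the
  value at the origin.
\<close>

section \<open>Multi-indices and formal power series\<close>

text \<open>
  Coefficients of products of formal power series serve twice: exponential series give the
  multinomial theorem, geometric series count the multi-indices of bounded degree.
\<close>

lemma fps_nth_prod_PiE:
  fixes F :: "'a \<Rightarrow> ('b::comm_ring_1) fps"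
  assumes "finite A"
  shows "fps_nth (\<Prod>i\<in>A. F i) n
    = (\<Sum>g \<in> {g \<in> A \<rightarrow>\<^sub>E UNIV. sum g A = n}. \<Prod>i\<in>A. fps_nth (F i) (g i))"
  using assms
proof (induction A arbitrary: n rule: finite_induct)
  case empty
  have "{g. g = (\<lambda>x. undefined) \<and> 0 = n} = (if n = 0 then {\<lambda>x::'a. undefined::nat} else {})"
    by auto
  then show ?case by simp
next
  case (insert a A)
  let ?S = "\<lambda>B m. {g \<in> B \<rightarrow>\<^sub>E (UNIV::nat set). sum g B = m}"
  have fin: "finite (?S A m)" for m
  proof (rule finite_subset)
    show "?S A m \<subseteq> A \<rightarrow>\<^sub>E {..m}"
      using insert.hyps(1) by (auto simp: PiE_iff extensional_def intro: member_le_sum)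
    show "finite (A \<rightarrow>\<^sub>E {..m})"
      using insert.hyps(1) by (intro finite_PiE) auto
  qed
  have "fps_nth (\<Prod>i\<in>insert a A. F i) n
      = (\<Sum>k=0..n. \<Sum>g\<in>?S A (n - k). fps_nth (F a) k * (\<Prod>i\<in>A. fps_nth (F i) (g i)))"
    using insert by (simp add: fps_mult_nth sum_distrib_left)
  also have "\<dots> = (\<Sum>(k, g)\<in>(SIGMA k:{0..n}. ?S A (n - k)).
      fps_nth (F a) k * (\<Prod>i\<in>A. fps_nth (F i) (g i)))"
    using fin by (simp add: sum.Sigma)
  also have "\<dots> = (\<Sum>g\<in>?S (insert a A) n. \<Prod>i\<in>insert a A. fps_nth (F i) (g i))"
  proof (rule sum.reindex_bij_witness[where
        i = "\<lambda>g. (g a, g(a := undefined))" and j = "\<lambda>(k, g). g(a := k)"])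
    fix p assume p: "p \<in> (SIGMA k:{0..n}. ?S A (n - k))"
    obtain k g where [simp]: "p = (k, g)" by (cases p)
    have g: "g \<in> A \<rightarrow>\<^sub>E UNIV" "sum g A = n - k" "k \<le> n" using p by auto
    have [simp]: "g a = undefined" using g(1) insert.hyps(2) by (auto simp: PiE_iff extensional_def)
    have s: "(\<Sum>i\<in>A. (g(a := k)) i) = sum g A"
      using insert.hyps(2) by (intro sum.cong) auto
    show "((case p of (k, g) \<Rightarrow> g(a := k)) a, (case p of (k, g) \<Rightarrow> g(a := k))(a := undefined)) = p"
      by (auto simp: fun_eq_iff)
    show "(case p of (k, g) \<Rightarrow> g(a := k)) \<in> ?S (insert a A) n"
      using g s insert.hyps by (auto simp: PiE_iff extensional_def)
    have "(\<Prod>i\<in>A. fps_nth (F i) ((g(a := k)) i)) = (\<Prod>i\<in>A. fps_nth (F i) (g i))"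
      using insert.hyps(2) by (intro prod.cong) auto
    then show "(\<Prod>i\<in>insert a A. fps_nth (F i) ((case p of (k, g) \<Rightarrow> g(a := k)) i))
        = (case p of (k, g) \<Rightarrow> fps_nth (F a) k * (\<Prod>i\<in>A. fps_nth (F i) (g i)))"
      using insert.hyps by simp
  next
    fix g assume g: "g \<in> ?S (insert a A) n"
    have s: "(\<Sum>i\<in>A. (g(a := undefined)) i) = sum g A"
      using insert.hyps(2) by (intro sum.cong) auto
    show "(case (g a, g(a := undefined)) of (k, g) \<Rightarrow> g(a := k)) = g" by auto
    show "(g a, g(a := undefined)) \<in> (SIGMA k:{0..n}. ?S A (n - k))"
      using g s insert.hyps by (auto simp: PiE_iff extensional_def)
  qed
  finally show ?case .
qed

lemma bij_betw_vec_nth: "bij_betw (vec_nth :: 'a ^ 'd \<Rightarrow> _) UNIV (UNIV \<rightarrow>\<^sub>E UNIV)"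
  by (rule bij_betw_byWitness[where f' = vec_lambda]) auto

lemma fps_nth_prod_mi:
  fixes F :: "'d::finite \<Rightarrow> ('b::comm_ring_1) fps"
  shows "fps_nth (\<Prod>i\<in>UNIV. F i) n = (\<Sum>l | mi_deg l = n. \<Prod>i\<in>UNIV. fps_nth (F i) (l $ i))"
proof -
  have "(\<Sum>l | mi_deg l = n. \<Prod>i\<in>UNIV. fps_nth (F i) (l $ i))
    = (\<Sum>g \<in> {g \<in> UNIV \<rightarrow>\<^sub>E UNIV. sum g UNIV = n}. \<Prod>i\<in>UNIV. fps_nth (F i) (g i))"
    by (rule sum.reindex_bij_witness[where i = vec_lambda and j = vec_nth])
      (auto simp: mi_deg_def)
  then show ?thesis by (simp add: fps_nth_prod_PiE)
qed

lemma finite_mi_deg_le: "finite {l :: ('d::finite) multi_index. mi_deg l \<le> n}"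
proof -
  have "{l :: 'd multi_index. mi_deg l \<le> n} \<subseteq> vec_lambda ` (UNIV \<rightarrow>\<^sub>E {..n})"
  proof
    fix l :: "'d multi_index" assume l: "l \<in> {l. mi_deg l \<le> n}"
    have "l $ i \<le> n" for i
      using l member_le_sum[of i UNIV "\<lambda>i. l $ i"] by (simp add: mi_deg_def)
    then show "l \<in> vec_lambda ` (UNIV \<rightarrow>\<^sub>E {..n})"
      by (intro image_eqI[of _ _ "vec_nth l"]) auto
  qed
  then show ?thesis by (rule finite_subset) (intro finite_imageI finite_PiE; simp)
qed

text \<open>
  The multinomial theorem: both sides are the coefficient of \<open>X\<^sup>n\<close> in the product of the
  series \<open>exp (a\<^sub>i X)\<close>, which is the exponential series of the sum.
\<close>

lemma sum_mi_power_div_fact: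
  fixes a :: "real ^ ('d::finite)"
  shows "(\<Sum>l | mi_deg l = n. mi_power a l / mi_fact l) = (\<Sum>i\<in>UNIV. a $ i) ^ n / fact n"
proof -
  have "(\<Prod>i\<in>B. fps_exp (a $ i)) = fps_exp (\<Sum>i\<in>B. a $ i)" if "finite B" for B
    using that by (induction B rule: finite_induct) (auto simp: fps_exp_add_mult)
  from this[of UNIV]
  have "fps_nth (\<Prod>i\<in>UNIV. fps_exp (a $ i)) n = (\<Sum>i\<in>UNIV. a $ i) ^ n / fact n"
    by simp
  then show ?thesis
    by (simp add: fps_nth_prod_mi mi_power_def mi_fact_def prod_dividef)
qed

lemma fps_nth_geometric_power:
  "fps_nth (Abs_fps (\<lambda>_. 1 :: 'a::comm_ring_1) ^ Suc m) n = of_nat ((n + m) choose m)"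
proof (induction m arbitrary: n)
  case (Suc m)
  have "fps_nth (Abs_fps (\<lambda>_. 1 :: 'a) ^ Suc (Suc m)) n
      = (\<Sum>k=0..n. fps_nth (Abs_fps (\<lambda>_. 1 :: 'a) ^ Suc m) k)"
    by (subst power_Suc2, subst fps_mult_nth) simp
  also have "\<dots> = of_nat (\<Sum>k\<le>n. (m + k) choose m)"
    by (simp only: Suc of_nat_sum atLeast0AtMost add.commute)
  also have "\<dots> = of_nat ((n + Suc m) choose Suc m)"
    by (simp only: choose_rising_sum(1)) (simp add: add_ac)
  finally show ?case .
qed simp

text \<open>
  In \<open>d\<close> variables, the multi-indices of degree exactly \<open>n\<close> are counted by the coefficients of
  \<open>(1 - X)\<^sup>-\<^sup>d\<close>; one further geometric factor sums these coefficients up to \<open>j\<close>.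
\<close>

lemma card_mi_deg_le:
  "card {l :: ('d::finite) multi_index. mi_deg l \<le> j} = (j + CARD('d)) choose CARD('d)"
proof -
  let ?g = "Abs_fps (\<lambda>_. 1 :: int)"
  have eq: "fps_nth (?g ^ CARD('d)) n = int (card {l :: 'd multi_index. mi_deg l = n})" for n
    using fps_nth_prod_mi[of "\<lambda>_::'d. ?g" n] by simp
  have fin: "finite {l :: 'd multi_index. mi_deg l = n}" for n
    by (rule finite_subset[OF _ finite_mi_deg_le[of n]]) auto
  have "{l :: 'd multi_index. mi_deg l \<le> j} = (\<Union>n\<in>{0..j}. {l. mi_deg l = n})" by auto
  then have "int (card {l :: 'd multi_index. mi_deg l \<le> j})
      = (\<Sum>n=0..j. int (card {l :: 'd multi_index. mi_deg l = n}))"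
    using fin by (simp only:) (subst card_UN_disjoint, auto)
  also have "\<dots> = fps_nth (?g ^ CARD('d) * ?g) j"
    by (simp add: fps_mult_nth eq)
  also have "\<dots> = int ((j + CARD('d)) choose CARD('d))"
    using fps_nth_geometric_power[of "CARD('d)" j, where 'a = int] by (simp add: mult.commute)
  finally show ?thesis by simp
qed

text \<open>
  Monotonicity of the degree makes the positions of the multi-indices of bounded degree an initial
  segment of the naturals, so their number alone determines which segment it is.
\<close>

lemma graded_enumeration_image:
  fixes e :: "nat \<Rightarrow> ('d::finite) multi_index"
  assumes "graded_enumeration e"
  shows "e ` {..<(j + CARD('d)) choose CARD('d)} = {l. mi_deg l \<le> j}"
proof -
  from assms have bij: "bij e" and mono: "mono (\<lambda>k. mi_deg (e k))"
    by (auto simp: graded_enumeration_def)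
  define K where "K = {k. mi_deg (e k) \<le> j}"
  have "K = e -` {l. mi_deg l \<le> j}" by (auto simp: K_def)
  then have img: "e ` K = {l. mi_deg l \<le> j}"
    by (simp only: surj_image_vimage_eq[OF bij_is_surj[OF bij]])
  have inj: "inj_on e K" using bij by (auto simp: bij_def inj_on_def)
  have card: "card K = (j + CARD('d)) choose CARD('d)"
    using card_image[OF inj] by (simp add: img card_mi_deg_le)
  have fin: "finite K"
    using finite_imageD[OF _ inj] finite_mi_deg_le[of j] by (simp add: img)
  have "K = {..<card K}"
  proof (rule card_subset_eq[symmetric])
    have down: "m \<in> K" if "k \<in> K" "m \<le> k" for k m
      using monoD[OF mono that(2)] that(1) by (simp add: K_def)
    show "{..<card K} \<subseteq> K"
    proof (rule ccontr)
      assume "\<not> {..<card K} \<subseteq> K"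
      then obtain m where m: "m < card K" "m \<notin> K" by auto
      then have "K \<subseteq> {..<m}" using down not_less by blast
      then show False using m(1) card_mono[of "{..<m}" K] by simp
    qed
  qed (use fin in auto)
  then show ?thesis using img card by simp
qed

section \<open>One-dimensional Hermite series\<close>

text \<open>
  For \<open>\<epsilon> = 0\<close> the recurrence keeps the even and the odd terms bounded.  A perturbation that tends
  to zero can only add growth slower than every geometric sequence: as soon as
  \<open>\<epsilon>\<^sub>n R + 1 \<le> R\<^sup>2\<close>, a bound by \<open>C R\<^sup>n\<close> reproduces itself.
\<close>

lemma subexponential_growth:
  fixes a \<epsilon> :: "nat \<Rightarrow> real"
  assumes nonneg: "\<And>n. 0 \<le> a n"
    and step: "\<And>n. a (Suc (Suc n)) \<le> \<epsilon> n * a (Suc n) + a n"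
    and \<epsilon>: "\<epsilon> \<longlonglongrightarrow> 0" and eps_nonneg: "\<And>n. 0 \<le> \<epsilon> n" and R: "1 < R"
  shows "\<exists>C. \<forall>n. a n \<le> C * R ^ n"
proof -
  have "0 < (R\<^sup>2 - 1) / R" using R by simp
  then have "\<forall>\<^sub>F n in sequentially. \<epsilon> n < (R\<^sup>2 - 1) / R"
    using order_tendstoD(2)[OF \<epsilon>] by blast
  then obtain n0 where "\<epsilon> n < (R\<^sup>2 - 1) / R" if "n \<ge> n0" for n
    by (auto simp: eventually_sequentially)
  then have n0: "\<epsilon> n * R + 1 \<le> R\<^sup>2" if "n \<ge> n0" for n
    using R that by (fastforce simp: pos_less_divide_eq)
  \<comment> \<open>Since \<open>R > 1\<close>, any constant that dominates the first terms starts the induction.\<close>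
  define C where "C = (\<Sum>k\<le>Suc n0. a k)"
  have C: "0 \<le> C" unfolding C_def by (intro sum_nonneg nonneg)
  have "a n \<le> C * R ^ n" for n
  proof (induction n rule: less_induct)
    case (less n)
    show ?case
    proof (cases "n \<le> Suc n0")
      case True
      then have "a n \<le> C"
        unfolding C_def using nonneg by (intro member_le_sum) auto
      also have "\<dots> \<le> C * R ^ n"
        using C R by (simp add: mult_le_cancel_left1)
      finally show ?thesis .
    next
      case False
      then obtain m where m: "n = Suc (Suc m)" "m \<ge> n0"
        by (metis Suc_le_eq not_less_eq_eq Suc_le_D Suc_le_mono)
      have "a n \<le> \<epsilon> m * a (Suc m) + a m" unfolding m by (rule step)
      also have "\<dots> \<le> \<epsilon> m * (C * R ^ Suc m) + C * R ^ m"
        using less.IH[of m] less.IH[of "Suc m"] m eps_nonneg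
        by (intro add_mono mult_left_mono) auto
      also have "\<dots> = C * R ^ m * (\<epsilon> m * R + 1)" by (simp add: algebra_simps)
      also have "\<dots> \<le> C * R ^ m * R\<^sup>2"
        using C R n0[OF m(2)] by (intro mult_left_mono) auto
      also have "\<dots> = C * R ^ n" by (simp add: m power2_eq_square)
      finally show ?thesis .
    qed
  qed
  then show ?thesis by blast
qed

definition mehler_coeff :: "real \<Rightarrow> nat \<Rightarrow> real" where
  "mehler_coeff x n = (hermite n x)\<^sup>2 / (2 ^ n * fact n)"

lemma mehler_coeff_nonneg: "0 \<le> mehler_coeff x n"
  by (simp add: mehler_coeff_def)

text \<open>
  The absolute values of the normalised polynomials \<open>h\<^sub>n(x) / sqrt (2\<^sup>n n!)\<close> satisfy the hypotheses
  of \<open>subexponential_growth\<close> with \<open>\<epsilon>\<^sub>n = 2|x| / sqrt (2(n+2))\<close>.  This is what makes Mehler's series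
  converge for every \<open>|t| < 1\<close>.
\<close>

lemma mehler_coeff_bound:
  assumes R: "1 < R"
  shows "\<exists>C. \<forall>n. mehler_coeff x n \<le> C * R ^ n"
proof -
  define S where "S n = sqrt (2 ^ n * fact n)" for n
  define a where "a n = \<bar>hermite n x\<bar> / S n" for n
  define \<epsilon> where "\<epsilon> n = 2 * \<bar>x\<bar> / sqrt (2 * real (n + 2))" for n
  have S0: "0 < S n" for n by (simp add: S_def)
  have S_Suc: "S (Suc n) = sqrt (2 * real (n + 1)) * S n" for n
    by (simp add: S_def real_sqrt_mult[symmetric] algebra_simps)
  have step: "a (Suc (Suc n)) \<le> \<epsilon> n * a (Suc n) + a n" for n
  proof -
    define u where "u = sqrt (2 * real (n + 1))"
    define w where "w = sqrt (2 * real (n + 2))"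
    have uw: "0 < u" "u \<le> w" "2 * real (Suc n) = u * u" by (auto simp: u_def w_def)
    have "\<bar>hermite (Suc (Suc n)) x\<bar> \<le> 2 * \<bar>x\<bar> * \<bar>hermite (Suc n) x\<bar> + u * u * \<bar>hermite n x\<bar>"
      unfolding hermite.simps(3) uw(3)
      using abs_triangle_ineq4[of "2 * x * hermite (Suc n) x" "u * u * hermite n x"] uw(1)
      by (simp add: abs_mult)
    also have "\<dots> \<le> 2 * \<bar>x\<bar> * \<bar>hermite (Suc n) x\<bar> + u * w * \<bar>hermite n x\<bar>"
      using uw by (intro add_left_mono mult_right_mono mult_left_mono) auto
    finally have "a (Suc (Suc n))
        \<le> (2 * \<bar>x\<bar> * \<bar>hermite (Suc n) x\<bar> + u * w * \<bar>hermite n x\<bar>) / S (Suc (Suc n))"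
      unfolding a_def using S0[of "Suc (Suc n)"] by (intro divide_right_mono) auto
    also have "S (Suc (Suc n)) = w * u * S n"
      using S_Suc[of "Suc n"] S_Suc[of n] by (simp add: u_def w_def)
    also have "(2 * \<bar>x\<bar> * \<bar>hermite (Suc n) x\<bar> + u * w * \<bar>hermite n x\<bar>) / (w * u * S n)
        = 2 * \<bar>x\<bar> / w * (\<bar>hermite (Suc n) x\<bar> / (u * S n)) + \<bar>hermite n x\<bar> / S n"
      using uw(1,2) S0[of n] by (simp add: field_simps)
    also have "\<dots> = \<epsilon> n * a (Suc n) + a n"
      using S_Suc[of n] by (simp add: a_def \<epsilon>_def u_def w_def)
    finally show ?thesis .
  qed
  have "\<epsilon> \<longlonglongrightarrow> 0"
    unfolding \<epsilon>_def
    by (intro real_tendsto_divide_at_top[OF tendsto_const] filterlim_compose[OF sqrt_at_top]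
        filterlim_tendsto_pos_mult_at_top[OF tendsto_const]
        filterlim_compose[OF filterlim_real_sequentially] filterlim_add_const_nat_at_top) simp
  \<comment> \<open>The growth rate \<open>sqrt R\<close> becomes \<open>R\<close> when the normalised polynomials are squared.\<close>
  then obtain C where C: "\<And>n. a n \<le> C * sqrt R ^ n"
    using subexponential_growth[of a \<epsilon> "sqrt R"] step R S0
    by (auto simp: a_def \<epsilon>_def less_imp_le)
  have "mehler_coeff x n \<le> C\<^sup>2 * R ^ n" for n
  proof -
    have "mehler_coeff x n = (a n)\<^sup>2"
      by (simp add: mehler_coeff_def a_def S_def power_divide)
    also have "\<dots> \<le> (C * sqrt R ^ n)\<^sup>2"
      using C[of n] S0[of n] by (intro power_mono) (auto simp: a_def less_imp_le)
    also have "\<dots> = C\<^sup>2 * R ^ n"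
      using R by (simp add: power_mult_distrib power_mult[symmetric] mult.commute[of n])
        (simp add: power_mult)
    finally show ?thesis .
  qed
  then show ?thesis by blast
qed

lemma summable_mehler:
  fixes t :: real
  assumes "\<bar>t\<bar> < 1"
  shows "summable (\<lambda>n. mehler_coeff x n * t ^ n)"
proof -
  obtain K where K: "\<bar>t\<bar> < K" "K < 1" using dense[OF assms] by blast
  then have K0: "0 < K" by linarith
  obtain C where C: "\<And>n. mehler_coeff x n \<le> C * (1 / K) ^ n"
    using mehler_coeff_bound[of "1 / K" x] K(2) K0 by auto
  show ?thesis
  proof (rule summable_comparison_test')
    show "summable (\<lambda>n. C * (\<bar>t\<bar> / K) ^ n)"
      using K K0 by (intro summable_mult summable_geometric) simp
    show "norm (mehler_coeff x n * t ^ n) \<le> C * (\<bar>t\<bar> / K) ^ n" for n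
    proof -
      have "norm (mehler_coeff x n * t ^ n) = mehler_coeff x n * \<bar>t\<bar> ^ n"
        by (simp add: abs_mult power_abs mehler_coeff_nonneg)
      also have "\<dots> \<le> C * (1 / K) ^ n * \<bar>t\<bar> ^ n"
        using C by (intro mult_right_mono) auto
      also have "\<dots> = C * (\<bar>t\<bar> / K) ^ n" by (simp add: power_divide)
      finally show ?thesis .
    qed
  qed
qed

text \<open>
  With \<open>a\<^sub>n = h\<^sub>n\<^sup>2 / (2\<^sup>n n!)\<close>, \<open>b\<^sub>n = h\<^sub>n h\<^sub>n\<^sub>+\<^sub>1 / (2\<^sup>n n!)\<close> and their power series \<open>A(t)\<close> and \<open>B(t)\<close>, the
  three-term recurrence yields \<open>(1 + t) B = 2xA\<close> and \<open>A' = x(1 - t)B + t(tA)'\<close>.  Eliminating \<open>B\<close>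
  leaves an equation for \<open>A\<close> alone.
\<close>

lemma mehler_ODE:
  fixes t :: real
  assumes t: "\<bar>t\<bar> < 1"
  shows "((\<lambda>t. \<Sum>n. mehler_coeff x n * t ^ n) has_real_derivative
    (2 * x\<^sup>2 / (1 + t)\<^sup>2 + t / (1 - t\<^sup>2)) * (\<Sum>n. mehler_coeff x n * t ^ n)) (at t)"
proof -
  define a where "a = mehler_coeff x"
  define b where "b n = hermite n x * hermite (Suc n) x / (2 ^ n * fact n)" for n
  define A where "A = (\<Sum>n. a n * t ^ n)"
  define A' where "A' = (\<Sum>n. diffs a n * t ^ n)"
  define B where "B = (\<Sum>n. b n * t ^ n)"
  have sumA: "summable (\<lambda>n. a n * s ^ n)" if "\<bar>s\<bar> < 1" for s
    unfolding a_def by (rule summable_mehler[OF that])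
  have sumA': "summable (\<lambda>n. diffs a n * s ^ n)" if "\<bar>s\<bar> < 1" for s
    using termdiff_converges[of s 1 a] sumA that by simp
  have a: "0 \<le> a n" for n by (simp add: a_def mehler_coeff_nonneg)
  have diffs_a: "diffs a n = (hermite (Suc n) x)\<^sup>2 / (2 * (2 ^ n * fact n))" for n
  proof -
    have "(q::real) * (h / (2 * p * (q * f))) = h / (2 * (p * f))" if "q \<noteq> 0" for q h p f
      using that by simp
    from this[of "real (Suc n)"] show ?thesis
      by (simp only: diffs_def a_def mehler_coeff_def fact_Suc power_Suc of_nat_id)
  qed
  \<comment> \<open>Mixed products are dominated by squares, so \<open>B\<close> converges wherever \<open>A\<close> and \<open>A'\<close> do.\<close>
  have b_bound: "\<bar>b n\<bar> \<le> a n + 2 * diffs a n" for n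
  proof -
    have "\<bar>u * v\<bar> \<le> u\<^sup>2 + v\<^sup>2" for u v :: real
    proof -
      have "2 * (\<bar>u\<bar> * \<bar>v\<bar>) \<le> u\<^sup>2 + v\<^sup>2"
        using sum_squares_bound[of "\<bar>u\<bar>" "\<bar>v\<bar>"] by (simp add: mult.assoc)
      moreover have "0 \<le> \<bar>u\<bar> * \<bar>v\<bar>" by simp
      ultimately show ?thesis unfolding abs_mult by linarith
    qed
    from this[of "hermite n x" "hermite (Suc n) x"]
    have "\<bar>hermite n x * hermite (Suc n) x\<bar> \<le> (hermite n x)\<^sup>2 + (hermite (Suc n) x)\<^sup>2" .
    then show ?thesis
      unfolding diffs_a by (simp add: b_def a_def mehler_coeff_def divide_simps abs_mult del: hermite.simps)
  qed
  have sumB: "summable (\<lambda>n. b n * t ^ n)"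
  proof (rule summable_comparison_test')
    show "summable (\<lambda>n. a n * \<bar>t\<bar> ^ n + 2 * (diffs a n * \<bar>t\<bar> ^ n))"
      using sumA[of "\<bar>t\<bar>"] sumA'[of "\<bar>t\<bar>"] t by (intro summable_add summable_mult) auto
    show "norm (b n * t ^ n) \<le> a n * \<bar>t\<bar> ^ n + 2 * (diffs a n * \<bar>t\<bar> ^ n)" for n
      using mult_right_mono[OF b_bound[of n], of "\<bar>t\<bar> ^ n"]
      by (simp add: abs_mult power_abs algebra_simps)
  qed
  have b_Suc: "b (Suc n) = 2 * x * a (Suc n) - b n" for n
  proof -
    have "v * (2 * x * v - 2 * m * u) / (2 * p * (m * f)) = 2 * x * (v\<^sup>2 / (2 * p * (m * f))) - u * v / (p * f)"
      if "m \<noteq> 0" "p \<noteq> 0" "f \<noteq> 0" for u v m p f :: real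
      using that by (simp add: field_simps power2_eq_square)
    from this[of "real (Suc n)" "2 ^ n" "fact n"] show ?thesis
      unfolding b_def a_def mehler_coeff_def fact_Suc power_Suc hermite.simps(3) by simp
  qed
  have d_Suc: "diffs a (Suc n) = x * b (Suc n) - x * b n + real (Suc n) * a n" for n
  proof -
    have "(hermite (Suc (Suc n)) x)\<^sup>2 = 2 * x * (hermite (Suc n) x * hermite (Suc (Suc n)) x)
        - 4 * x * real (Suc n) * (hermite n x * hermite (Suc n) x)
        + 4 * (real (Suc n))\<^sup>2 * (hermite n x)\<^sup>2"
    proof -
      have "(2 * x * v - 2 * m * u)\<^sup>2 = 2 * x * (v * (2 * x * v - 2 * m * u))
          - 4 * x * m * (u * v) + 4 * m\<^sup>2 * u\<^sup>2" for u v m :: real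
        by (simp add: power2_eq_square algebra_simps)
      then show ?thesis unfolding hermite.simps(3) .
    qed
    moreover have "w\<^sup>2 / (2 * (2 * p * (m * f)))
        = x * (v * w / (2 * p * (m * f))) - x * (u * v / (p * f)) + m * (u\<^sup>2 / (p * f))"
      if "m \<noteq> 0" "p \<noteq> 0" "f \<noteq> 0"
        "w\<^sup>2 = 2 * x * (v * w) - 4 * x * m * (u * v) + 4 * m\<^sup>2 * u\<^sup>2"
      for u v w m p f :: real
      unfolding that(4) using that(1-3)
      by (simp add: diff_divide_distrib add_divide_distrib) (simp add: field_simps power2_eq_square)
    ultimately have "(hermite (Suc (Suc n)) x)\<^sup>2 / (2 * (2 * 2 ^ n * (real (Suc n) * fact n)))
        = x * (hermite (Suc n) x * hermite (Suc (Suc n)) x / (2 * 2 ^ n * (real (Suc n) * fact n)))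
          - x * (hermite n x * hermite (Suc n) x / (2 ^ n * fact n))
          + real (Suc n) * ((hermite n x)\<^sup>2 / (2 ^ n * fact n))"
      by simp
    then show ?thesis
      unfolding diffs_a unfolding b_def a_def mehler_coeff_def fact_Suc power_Suc by simp
  qed
  have shift: "(\<lambda>n. f n * t ^ Suc n) sums (t * F)" if "(\<lambda>n. f n * t ^ n) sums F"
    for f :: "nat \<Rightarrow> real" and F
    using sums_mult[OF that, of t] by (simp add: algebra_simps)
  have Asums: "(\<lambda>n. a n * t ^ n) sums A" and A'sums: "(\<lambda>n. diffs a n * t ^ n) sums A'"
    and Bsums: "(\<lambda>n. b n * t ^ n) sums B"
    using sumA[OF t] sumA'[OF t] sumB by (auto simp: A_def A'_def B_def)
  have tailsums: "(\<lambda>n. f (Suc n) * t ^ Suc n) sums (F - f 0)"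
    if "(\<lambda>n. f n * t ^ n) sums F" for f :: "nat \<Rightarrow> real" and F
    using that by (subst sums_Suc_iff) simp
  have B: "(1 + t) * B = 2 * x * A"
  proof -
    have "(\<lambda>n. 2 * x * (a (Suc n) * t ^ Suc n) - b n * t ^ Suc n)
        sums (2 * x * (A - a 0) - t * B)"
      by (intro sums_diff sums_mult tailsums shift Asums Bsums)
    moreover have "(\<lambda>n. 2 * x * (a (Suc n) * t ^ Suc n) - b n * t ^ Suc n)
        = (\<lambda>n. b (Suc n) * t ^ Suc n)"
      by (simp add: b_Suc algebra_simps)
    ultimately have "B - b 0 = 2 * x * (A - a 0) - t * B"
      using sums_unique2[OF tailsums[OF Bsums]] by simp
    moreover have "b 0 = 2 * x * a 0" by (simp add: b_def a_def mehler_coeff_def)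
    ultimately show ?thesis by (simp add: algebra_simps)
  qed
  have A': "(1 - t\<^sup>2) * A' = x * (1 - t) * B + t * A"
  proof -
    have "(\<lambda>n. real n * a n * t ^ n) sums (t * A')"
    proof -
      have "(\<lambda>n. diffs a n * t ^ Suc n) sums (t * A')" by (rule shift[OF A'sums])
      then have "(\<lambda>n. real (Suc n) * a (Suc n) * t ^ Suc n) sums (t * A')"
        by (simp add: diffs_def)
      then show ?thesis by (subst (asm) sums_Suc_iff) simp
    qed
    from sums_add[OF this Asums]
    have "(\<lambda>n. real (Suc n) * a n * t ^ n) sums (t * A' + A)"
      by (simp add: algebra_simps)
    then have "(\<lambda>n. x * (b (Suc n) * t ^ Suc n) - x * (b n * t ^ Suc n) + real (Suc n) * a n * t ^ Suc n)
        sums (x * (B - b 0) - x * (t * B) + t * (t * A' + A))"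
      by (intro sums_add sums_diff sums_mult tailsums shift Bsums)
    moreover have "(\<lambda>n. x * (b (Suc n) * t ^ Suc n) - x * (b n * t ^ Suc n) + real (Suc n) * a n * t ^ Suc n)
        = (\<lambda>n. diffs a (Suc n) * t ^ Suc n)"
      by (simp only: d_Suc) (simp add: algebra_simps)
    ultimately have "A' - diffs a 0 = x * (B - b 0) - x * (t * B) + t * (t * A' + A)"
      using sums_unique2[OF tailsums[OF A'sums]] by simp
    moreover have "diffs a 0 = x * b 0"
      by (simp add: diffs_a b_def power2_eq_square)
    ultimately show ?thesis by (simp add: algebra_simps power2_eq_square)
  qed
  have nz: "1 + t \<noteq> 0" "1 - t \<noteq> 0" using t by auto
  have fac: "1 - t\<^sup>2 = (1 + t) * (1 - t)" by (simp add: power2_eq_square algebra_simps)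
  have "A' = (2 * x\<^sup>2 / (1 + t)\<^sup>2 + t / (1 - t\<^sup>2)) * A"
  proof -
    have B': "B = 2 * x * A / (1 + t)" using B nz by (simp add: field_simps)
    have "A' = (x * (1 - t) * B + t * A) / (1 - t\<^sup>2)"
    proof -
      have "1 - t\<^sup>2 \<noteq> 0" using nz by (simp add: fac)
      then show ?thesis using A' by (metis nonzero_mult_div_cancel_left)
    qed
    also have "\<dots> = (2 * x\<^sup>2 / (1 + t)\<^sup>2 + t / (1 - t\<^sup>2)) * A"
      unfolding B' fac using nz by (simp add: divide_simps) (simp add: algebra_simps power2_eq_square)
    finally show ?thesis .
  qed
  moreover have "((\<lambda>t. \<Sum>n. a n * t ^ n) has_real_derivative A') (at t)"
    unfolding A'_def using termdiffs_strong'[of 1 a t] sumA t by simp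
  ultimately show ?thesis by (simp add: A_def a_def)
qed

text \<open>
  Mehler's formula on the diagonal.  The series times the reciprocal of the right-hand side has
  derivative zero, and it equals one at the origin.
\<close>

lemma mehler_diagonal:
  fixes t :: real
  assumes t: "\<bar>t\<bar> < 1"
  shows "(\<lambda>n. mehler_coeff x n * t ^ n) sums (exp (2 * t * x\<^sup>2 / (1 + t)) / sqrt (1 - t\<^sup>2))"
proof -
  define A where "A t = (\<Sum>n. mehler_coeff x n * t ^ n)" for t
  define g where "g t = A t * (exp (- (2 * t * x\<^sup>2 / (1 + t))) * sqrt (1 - t\<^sup>2))" for t
  have sq: "0 < 1 - s\<^sup>2" if "\<bar>s\<bar> < 1" for s :: real
    using that abs_square_less_1[of s] by simp
  have deriv: "(g has_real_derivative 0) (at s within {-1<..<1})" if "s \<in> {-1<..<1}" for s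
  proof -
    have s: "\<bar>s\<bar> < 1" "1 + s \<noteq> 0" using that by auto
    define r where "r = sqrt (1 - s\<^sup>2)"
    have r: "r \<noteq> 0" "1 - s\<^sup>2 = r\<^sup>2" using sq[OF s(1)] by (auto simp: r_def)
    have q: "((\<lambda>s. 2 * s * x\<^sup>2 / (1 + s)) has_real_derivative 2 * x\<^sup>2 / (1 + s)\<^sup>2) (at s)"
      using s by (auto intro!: derivative_eq_intros simp: field_simps power2_eq_square)
    have "((\<lambda>s. sqrt (1 - s\<^sup>2)) has_real_derivative - (s / r)) (at s)"
      using sq[OF s(1)] by (auto intro!: derivative_eq_intros simp: r_def field_simps)
    note sqrt_deriv = this
    let ?e = "exp (- (2 * s * x\<^sup>2 / (1 + s)))" and ?k = "2 * x\<^sup>2 / (1 + s)\<^sup>2"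
    have "(g has_real_derivative (?k + s / (1 - s\<^sup>2)) * A s * (?e * r)
        + (?e * - ?k * r + - (s / r) * ?e) * A s) (at s)"
      unfolding g_def A_def r_def
      by (rule DERIV_mult[OF mehler_ODE[OF s(1)]
          DERIV_mult[OF DERIV_fun_exp[OF DERIV_minus[OF q]] sqrt_deriv[unfolded r_def]]])
    moreover have "(?k + s / (1 - s\<^sup>2)) * A s * (?e * r) + (?e * - ?k * r + - (s / r) * ?e) * A s = 0"
    proof -
      have "(k + s / r\<^sup>2) * B * (e * r) + (e * - k * r + - (s / r) * e) * B = 0" for k e B :: real
      proof -
        have "s / r\<^sup>2 * r = s / r" using r(1) by (simp add: power2_eq_square)
        moreover have "(k + u) * B * (e * r) = B * e * (k * r) + B * e * (u * r)" for u
          by (simp add: distrib_left distrib_right mult_ac)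
        ultimately have "(k + s / r\<^sup>2) * B * (e * r) = B * e * (k * r) + B * e * (s / r)"
          by simp
        then show ?thesis by (simp only: distrib_right distrib_left) (simp add: mult_ac)
      qed
      from this[of ?k "A s" ?e] show ?thesis unfolding r(2) .
    qed
    ultimately have "(g has_real_derivative 0) (at s)" 
      by (rule back_subst[where P = "\<lambda>D. (g has_real_derivative D) (at s)"])
    then show ?thesis by (rule has_field_derivative_at_within)
  qed
  have "\<exists>c. \<forall>s\<in>{-1<..<1}. g s = c"
    by (rule has_field_derivative_zero_constant) (use deriv in auto)
  moreover have "t \<in> {-1<..<1}" "(0::real) \<in> {-1<..<1}" using t by (auto simp: abs_less_iff)
  ultimately have "g t = g 0" by metis
  also have "g 0 = 1"
  proof -
    have "A 0 = 1" unfolding A_def powser_zero by (simp add: mehler_coeff_def)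
    then show ?thesis by (simp add: g_def)
  qed
  finally have "A t = exp (2 * t * x\<^sup>2 / (1 + t)) / sqrt (1 - t\<^sup>2)"
    using sq[OF t] by (simp add: g_def exp_minus field_simps)
  then show ?thesis using summable_sums[OF summable_mehler[OF t, of x]] by (simp add: A_def)
qed

text \<open>
  The square of the \<open>n\<close>-th term is the product of a term of Mehler's series at \<open>1/2\<close> and a term of
  the exponential series at \<open>4 s\<^sup>2\<close>; the inequality of the means compares with the sum of the two.
  Absolute convergence is what allows the series to be multiplied over the coordinates.
\<close>

lemma summable_hermite_generating:
  fixes s :: real
  shows "summable (\<lambda>n. \<bar>hermite n x / fact n * s ^ n\<bar>)"
proof (rule summable_comparison_test')
  show "summable (\<lambda>n. mehler_coeff x n * (1/2) ^ n + inverse (fact n) * (4 * s\<^sup>2) ^ n)"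
    by (intro summable_add summable_mehler summable_exp) simp
  show "norm \<bar>hermite n x / fact n * s ^ n\<bar>
      \<le> mehler_coeff x n * (1/2) ^ n + inverse (fact n) * (4 * s\<^sup>2) ^ n" for n
  proof -
    let ?P = "mehler_coeff x n * (1/2) ^ n" and ?Q = "inverse (fact n) * (4 * s\<^sup>2) ^ n"
    have "(4::real) ^ n = 2 ^ n * 2 ^ n" by (simp add: power_mult_distrib[symmetric])
    then have "(hermite n x / fact n * s ^ n)\<^sup>2 = ?P * ?Q"
      by (simp add: mehler_coeff_def power_mult_distrib power_divide power2_eq_square field_simps)
    then have "\<bar>hermite n x / fact n * s ^ n\<bar> = sqrt (?P * ?Q)"
      by (metis real_sqrt_abs)
    also have "\<dots> \<le> (?P + ?Q) / 2"
      by (intro arith_geo_mean_sqrt) (auto simp: mehler_coeff_nonneg)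
    also have "\<dots> \<le> ?P + ?Q"
      using mehler_coeff_nonneg[of x n] by simp
    finally show ?thesis by simp
  qed
qed

text \<open>
  For the series \<open>F(s)\<close> the three-term recurrence reads \<open>F' = (2x - 2s) F\<close>.
\<close>

lemma hermite_generating_function:
  fixes s :: real
  shows "(\<lambda>n. hermite n x / fact n * s ^ n) sums exp (2 * x * s - s\<^sup>2)"
proof -
  define c where "c n = hermite n x / fact n" for n
  define F where "F s = (\<Sum>n. c n * s ^ n)" for s
  have sum: "summable (\<lambda>n. c n * s ^ n)" for s
    unfolding c_def using summable_hermite_generating by (rule summable_rabs_cancel)
  have deriv: "(F has_real_derivative (2 * x - 2 * s) * F s) (at s)" for s
  proof -
    define F' where "F' = (\<Sum>n. diffs c n * s ^ n)"
    have Fs: "(\<lambda>n. c n * s ^ n) sums F s" using sum by (auto simp: F_def)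
    have F's: "(\<lambda>n. diffs c n * s ^ n) sums F'"
      unfolding F'_def using termdiff_converges_all[of c s] sum by auto
    have d_Suc: "diffs c (Suc n) = 2 * x * c (Suc n) - 2 * c n" for n
      by (simp add: diffs_def c_def divide_simps)
    have "(\<lambda>n. 2 * x * (c (Suc n) * s ^ Suc n) - 2 * s * (c n * s ^ n))
        sums (2 * x * (F s - c 0) - 2 * s * F s)"
    proof (intro sums_diff sums_mult Fs)
      show "(\<lambda>n. c (Suc n) * s ^ Suc n) sums (F s - c 0)"
        using Fs by (subst sums_Suc_iff) simp
    qed
    moreover have "(\<lambda>n. 2 * x * (c (Suc n) * s ^ Suc n) - 2 * s * (c n * s ^ n))
        = (\<lambda>n. diffs c (Suc n) * s ^ Suc n)"
      by (simp add: d_Suc algebra_simps)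
    moreover have "(\<lambda>n. diffs c (Suc n) * s ^ Suc n) sums (F' - diffs c 0)"
      using F's by (subst sums_Suc_iff) simp
    ultimately have "F' - diffs c 0 = 2 * x * (F s - c 0) - 2 * s * F s"
      using sums_unique2 by metis
    moreover have "diffs c 0 = 2 * x * c 0" by (simp add: diffs_def c_def)
    ultimately have "F' = (2 * x - 2 * s) * F s" by (simp add: algebra_simps)
    then show ?thesis
      unfolding F'_def F_def using termdiffs_strong_converges_everywhere[of c s] sum by simp
  qed
  have "\<exists>k. \<forall>s\<in>UNIV. F s * exp (s\<^sup>2 - 2 * x * s) = k"
  proof (rule has_field_derivative_zero_constant)
    show "((\<lambda>s. F s * exp (s\<^sup>2 - 2 * x * s)) has_real_derivative 0) (at s within UNIV)" for s
      using deriv[of s] by (auto intro!: derivative_eq_intros simp: algebra_simps)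
  qed simp
  then have "F s * exp (s\<^sup>2 - 2 * x * s) = F 0 * exp (0\<^sup>2 - 2 * x * 0)" by (metis UNIV_I)
  also have "\<dots> = 1"
  proof -
    have "F 0 = 1" unfolding F_def powser_zero by (simp add: c_def)
    then show ?thesis by simp
  qed
  finally have "F s * exp (s\<^sup>2 - 2 * x * s) = exp (2 * x * s - s\<^sup>2) * exp (s\<^sup>2 - 2 * x * s)"
    by (simp flip: exp_add)
  then have "F s = exp (2 * x * s - s\<^sup>2)" by simp
  then show ?thesis using summable_sums[OF sum[of s]] by (simp add: F_def c_def)
qed

section \<open>Series over multi-indices\<close>

lemma has_sum_prod_mi:
  fixes f :: "'d::finite \<Rightarrow> nat \<Rightarrow> real"
  assumes "\<And>i. (f i has_sum s i) UNIV"
  shows "((\<lambda>l :: 'd multi_index. \<Prod>i\<in>UNIV. f i (l $ i)) has_sum (\<Prod>i\<in>UNIV. s i)) UNIV"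
proof -
  let ?P = "\<lambda>g. \<Prod>i\<in>UNIV. f i (g i)"
  have abs: "(\<lambda>n. norm (f i n)) summable_on UNIV" for i
    using has_sum_imp_summable[OF assms, of i] summable_on_iff_abs_summable_on_real by blast
  have "?P summable_on (UNIV \<rightarrow>\<^sub>E UNIV)"
    by (rule abs_summable_summable, subst abs_summable_equivalent)
      (rule abs_summable_on_prod_PiE[OF finite_class.finite_UNIV countableI_type
          abs_summable_equivalent[THEN iffD1, OF abs]])
  moreover have "infsum ?P (UNIV \<rightarrow>\<^sub>E UNIV) = (\<Prod>i\<in>UNIV. s i)"
    using infsum_prod_PiE_abs[of UNIV f "\<lambda>_. UNIV"] abs infsumI[OF assms] by simp
  ultimately have "(?P has_sum (\<Prod>i\<in>UNIV. s i)) (UNIV \<rightarrow>\<^sub>E UNIV)"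
    by (simp add: has_sum_iff)
  then show ?thesis
    using has_sum_reindex_bij_betw[OF bij_betw_vec_nth, of ?P "\<Prod>i\<in>UNIV. s i"] by simp
qed

lemma mi_power_nonneg: "(\<And>i. 0 \<le> a $ i) \<Longrightarrow> 0 \<le> mi_power a l"
  by (simp add: mi_power_def prod_nonneg)

lemma mi_fact_pos: "0 < mi_fact l"
  by (simp add: mi_fact_def prod_pos)

lemma power_mi_deg: "c ^ mi_deg l = (\<Prod>i\<in>UNIV. c ^ (l $ i))"
  by (simp add: mi_deg_def power_sum)

lemma mi_power_mult: "mi_power a l * mi_power b l = mi_power (\<chi> i. a $ i * b $ i) l"
  by (simp add: mi_power_def power_mult_distrib prod.distrib)

text \<open>
  After shifting the index by \<open>k\<close>, the factor \<open>s\<^sup>k / k!\<close> splits off because \<open>n! k! \<le> (n + k)!\<close>.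
\<close>

lemma exp_tail_bound:
  fixes s :: real
  assumes "0 \<le> s"
  shows "(\<Sum>n=k..m. s ^ n / fact n) \<le> exp s * s ^ k / fact k"
proof -
  have "(\<Sum>n=k..m. s ^ n / fact n) = (\<Sum>n | k \<le> n \<and> n \<le> m. s ^ n / fact n)"
    by (intro sum.cong) auto
  also have "\<dots> \<le> (\<Sum>n\<in>(\<lambda>n. n + k) ` {..m}. s ^ n / fact n)"
  proof (rule sum_mono2)
    show "{n. k \<le> n \<and> n \<le> m} \<subseteq> (\<lambda>n. n + k) ` {..m}"
    proof
      fix n assume "n \<in> {n. k \<le> n \<and> n \<le> m}"
      then show "n \<in> (\<lambda>n. n + k) ` {..m}" by (intro image_eqI[of _ _ "n - k"]) auto
    qed
  qed (use assms in auto)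
  also have "\<dots> = (\<Sum>n\<le>m. s ^ (n + k) / fact (n + k))"
    by (subst sum.reindex) (auto simp: inj_on_def)
  also have "\<dots> \<le> (\<Sum>n\<le>m. s ^ n / fact n * (s ^ k / fact k))"
  proof (rule sum_mono)
    fix n
    have "fact n * fact k \<le> (fact (n + k) :: nat)"
      by (intro dvd_imp_le fact_fact_dvd_fact) simp
    then have "real (fact n * fact k) \<le> real (fact (n + k))" by (rule of_nat_mono)
    then have "fact n * fact k \<le> (fact (n + k) :: real)" by simp
    then have "s ^ (n + k) / fact (n + k) \<le> s ^ (n + k) / (fact n * fact k)"
      using assms by (intro divide_left_mono) auto
    then show "s ^ (n + k) / fact (n + k) \<le> s ^ n / fact n * (s ^ k / fact k)"
      by (simp add: power_add)
  qed
  also have "\<dots> = (\<Sum>n\<le>m. s ^ n / fact n) * (s ^ k / fact k)"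
    by (rule sum_distrib_right[symmetric])
  also have "\<dots> \<le> exp s * (s ^ k / fact k)"
  proof (rule mult_right_mono)
    have "(\<lambda>n. s ^ n / fact n) sums exp s"
      using exp_converges[of s] by (simp add: field_simps)
    then show "(\<Sum>n\<le>m. s ^ n / fact n) \<le> exp s"
      using assms sum_le_suminf[of "\<lambda>n. s ^ n / fact n" "{..m}"]
      by (simp add: sums_iff)
  qed (use assms in simp)
  finally show ?thesis by simp
qed

text \<open>
  Sorting a finite part of the tail by degree and applying the multinomial theorem in each degree
  bounds it by a part of the tail of \<open>exp s\<close>.  Since the terms are nonnegative, summability
  follows from the same bound.
\<close>

lemma mi_exp_tail:
  fixes a :: "real ^ ('d::finite)"
  assumes a: "\<And>i. 0 \<le> a $ i"
  defines "s \<equiv> \<Sum>i\<in>UNIV. a $ i"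
  shows "(\<lambda>l. mi_power a l / mi_fact l) summable_on {l. j < mi_deg l}"
    and "infsum (\<lambda>l. mi_power a l / mi_fact l) {l. j < mi_deg l}
      \<le> exp s * s ^ Suc j / fact (Suc j)"
proof -
  let ?f = "\<lambda>l. mi_power a l / mi_fact l"
  have nonneg: "0 \<le> ?f l" for l
    using a mi_power_nonneg[of a l] mi_fact_pos[of l] by simp
  have s: "0 \<le> s" unfolding s_def by (intro sum_nonneg a)
  have finite_deg: "finite {l :: 'd multi_index. mi_deg l = n}" for n
    by (rule finite_subset[OF _ finite_mi_deg_le[of n]]) auto
  have bound: "sum ?f F \<le> exp s * s ^ Suc j / fact (Suc j)"
    if F: "finite F" "F \<subseteq> {l. j < mi_deg l}" for F
  proof -
    obtain m where m: "\<And>l. l \<in> F \<Longrightarrow> mi_deg l \<le> m"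
      using finite_nat_set_iff_bounded_le[of "mi_deg ` F"] F(1) by auto
    have "sum ?f F \<le> sum ?f (\<Union>n\<in>{Suc j..m}. {l. mi_deg l = n})"
      using F m nonneg finite_deg by (intro sum_mono2) fastforce+
    also have "\<dots> = (\<Sum>n=Suc j..m. \<Sum>l | mi_deg l = n. ?f l)"
      using finite_deg by (intro sum.UNION_disjoint) auto
    also have "\<dots> = (\<Sum>n=Suc j..m. s ^ n / fact n)"
      by (simp add: sum_mi_power_div_fact s_def)
    also have "\<dots> \<le> exp s * s ^ Suc j / fact (Suc j)"
      by (rule exp_tail_bound[OF s])
    finally show ?thesis .
  qed
  show summ: "?f summable_on {l. j < mi_deg l}"
    by (rule nonneg_bdd_above_summable_on) (use bound nonneg in \<open>auto intro!: bdd_aboveI2\<close>)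
  show "infsum ?f {l. j < mi_deg l} \<le> exp s * s ^ Suc j / fact (Suc j)"
    by (rule infsum_le_finite_sums[OF summ bound])
qed

lemma Cauchy_Schwarz_infsum:
  fixes u w :: "'a \<Rightarrow> real"
  assumes u: "(\<lambda>k. (u k)\<^sup>2) summable_on A" and w: "(\<lambda>k. (w k)\<^sup>2) summable_on A"
  shows "(\<Sum>\<^sub>\<infinity>k\<in>A. u k * w k)\<^sup>2 \<le> (\<Sum>\<^sub>\<infinity>k\<in>A. (u k)\<^sup>2) * (\<Sum>\<^sub>\<infinity>k\<in>A. (w k)\<^sup>2)"
proof -
  have "(\<lambda>k. u k * w k) summable_on A"
    using u w unfolding power2_eq_square
    by (rule abs_summable_summable[OF abs_summable_product[OF
          summable_on_iff_abs_summable_on_real[THEN iffD1]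
          summable_on_iff_abs_summable_on_real[THEN iffD1]]])
  then have lim: "((\<lambda>F. (\<Sum>k\<in>F. u k * w k)\<^sup>2) \<longlongrightarrow> (\<Sum>\<^sub>\<infinity>k\<in>A. u k * w k)\<^sup>2)
      (finite_subsets_at_top A)"
    by (intro tendsto_power infsum_tendsto)
  have "(\<Sum>k\<in>F. u k * w k)\<^sup>2 \<le> (\<Sum>\<^sub>\<infinity>k\<in>A. (u k)\<^sup>2) * (\<Sum>\<^sub>\<infinity>k\<in>A. (w k)\<^sup>2)"
    if F: "finite F" "F \<subseteq> A" for F
  proof -
    have "(\<Sum>k\<in>F. u k * w k)\<^sup>2 \<le> (\<Sum>k\<in>F. (u k)\<^sup>2) * (\<Sum>k\<in>F. (w k)\<^sup>2)"
      by (rule Cauchy_Schwarz_ineq_sum)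
    also have "\<dots> \<le> (\<Sum>\<^sub>\<infinity>k\<in>A. (u k)\<^sup>2) * (\<Sum>\<^sub>\<infinity>k\<in>A. (w k)\<^sup>2)"
      by (intro mult_mono finite_sum_le_infsum u w F sum_nonneg infsum_nonneg) auto
    finally show ?thesis .
  qed
  then have "\<forall>\<^sub>F F in finite_subsets_at_top A.
      (\<Sum>k\<in>F. u k * w k)\<^sup>2 \<le> (\<Sum>\<^sub>\<infinity>k\<in>A. (u k)\<^sup>2) * (\<Sum>\<^sub>\<infinity>k\<in>A. (w k)\<^sup>2)"
    by (intro eventually_finite_subsets_at_top_weakI)
  then show ?thesis
    using tendsto_upperbound[OF lim] by simp
qed

section \<open>The squared basis functions\<close>

lemma sqrt_power_eq_powr:
  assumes "0 < x"
  shows "sqrt x ^ n = x powr (real n / 2)"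
proof -
  have "sqrt x ^ n = (x powr (1/2)) powr real n"
    using assms powr_realpow[of "sqrt x" n] powr_half_sqrt[of x] by simp
  then show ?thesis by (simp only: powr_powr) simp
qed

lemma H_basis_eq:
  assumes "0 < t"
  shows "H_basis G E t l x = sqrt (t ^ mi_deg l) / sqrt (2 ^ mi_deg l * mi_fact l)
       * hermite_mi l (Finite_Cartesian_Product.transpose G *v x)
       * exp (- (x \<bullet> ((Finite_Cartesian_Product.transpose E ** E) *v x)))"
proof -
  have "t powr (real (mi_deg l) / 2) = sqrt (t ^ mi_deg l)"
    using sqrt_power_eq_powr[OF assms, of "mi_deg l"] by (simp add: real_sqrt_power)
  then show ?thesis by (simp add: H_basis_def)
qed

lemma H_basis_sq:
  assumes "0 < t"
  shows "(H_basis G E t l x)\<^sup>2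
    = exp (- 2 * (x \<bullet> ((Finite_Cartesian_Product.transpose E ** E) *v x)))
      * (\<Prod>i\<in>UNIV. mehler_coeff ((Finite_Cartesian_Product.transpose G *v x) $ i) (l $ i) * t ^ (l $ i))"
proof -
  define z where "z = Finite_Cartesian_Product.transpose G *v x"
  define c where "c = x \<bullet> ((Finite_Cartesian_Product.transpose E ** E) *v x)"
  have "(H_basis G E t l x)\<^sup>2 = t ^ mi_deg l / (2 ^ mi_deg l * mi_fact l) * (hermite_mi l z)\<^sup>2 * (exp (- c))\<^sup>2"
    using assms mi_fact_pos[of l]
    by (simp add: H_basis_eq power_mult_distrib power_divide z_def c_def)
  also have "(exp (- c))\<^sup>2 = exp (- 2 * c)"
    by (simp add: exp_double[symmetric])
  also have "t ^ mi_deg l / (2 ^ mi_deg l * mi_fact l) * (hermite_mi l z)\<^sup>2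
      = (\<Prod>i\<in>UNIV. mehler_coeff (z $ i) (l $ i) * t ^ (l $ i))"
    unfolding hermite_mi_def mi_fact_def power_mi_deg mehler_coeff_def
    by (simp add: prod.distrib prod_dividef prod_power_distrib)
  finally show ?thesis by (simp add: z_def c_def)
qed

text \<open>
  The exponential weight does not depend on the multi-index, and the remaining series is a product
  of one Mehler series for each coordinate.
\<close>

lemma has_sum_H_basis_sq:
  fixes G E :: "real ^ 'd ^ ('d::finite)"
  assumes t: "0 < t" "t < 1"
  shows "((\<lambda>l. (H_basis G E t l x)\<^sup>2) has_sum
      exp (- 2 * (x \<bullet> ((Finite_Cartesian_Product.transpose E ** E) *v x))
           + 2 * t * (norm (Finite_Cartesian_Product.transpose G *v x))\<^sup>2 / (1 + t))
      / (1 - t\<^sup>2) powr (real CARD('d) / 2)) UNIV"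
proof -
  define z where "z = Finite_Cartesian_Product.transpose G *v x"
  define c where "c = exp (- 2 * (x \<bullet> ((Finite_Cartesian_Product.transpose E ** E) *v x)))"
  have t2: "0 < 1 - t\<^sup>2" using t abs_square_less_1[of t] by simp
  have "((\<lambda>n. mehler_coeff (z $ i) n * t ^ n) has_sum
      (exp (2 * t * (z $ i)\<^sup>2 / (1 + t)) / sqrt (1 - t\<^sup>2))) UNIV" for i
    by (rule sums_nonneg_imp_has_sum) (use t mehler_diagonal in \<open>auto simp: mehler_coeff_nonneg\<close>)
  then have "((\<lambda>l. c * (\<Prod>i\<in>UNIV. mehler_coeff (z $ i) (l $ i) * t ^ (l $ i))) has_sum
      c * (\<Prod>i\<in>UNIV. exp (2 * t * (z $ i)\<^sup>2 / (1 + t)) / sqrt (1 - t\<^sup>2))) UNIV"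
    by (intro has_sum_cmult_right has_sum_prod_mi)
  moreover have "(\<Prod>i\<in>UNIV. exp (2 * t * (z $ i)\<^sup>2 / (1 + t)) / sqrt (1 - t\<^sup>2))
      = exp (2 * t * (norm z)\<^sup>2 / (1 + t)) / (1 - t\<^sup>2) powr (real CARD('d) / 2)"
  proof -
    have "(norm z)\<^sup>2 = (\<Sum>i\<in>UNIV. (z $ i)\<^sup>2)"
      unfolding power2_norm_eq_inner inner_vec_def by (simp add: power2_eq_square)
    moreover have "sqrt (1 - t\<^sup>2) ^ CARD('d) = (1 - t\<^sup>2) powr (real CARD('d) / 2)"
      by (rule sqrt_power_eq_powr[OF t2])
    ultimately show ?thesis
      by (simp add: prod_dividef exp_sum[symmetric] sum_distrib_left sum_divide_distrib)
  qed
  moreover have "(H_basis G E t l x)\<^sup>2 = c * (\<Prod>i\<in>UNIV. mehler_coeff (z $ i) (l $ i) * t ^ (l $ i))" for l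
    unfolding c_def z_def by (rule H_basis_sq[OF t(1)])
  ultimately show ?thesis
    by (simp only: exp_add c_def[symmetric] z_def[symmetric] times_divide_eq_right)
qed

section \<open>Inverses and block matrices\<close>

lemma mat_inv_eqI:
  assumes A: "A \<in> carrier_mat n n" and B: "B \<in> carrier_mat n n"
    and AB: "A * B = 1\<^sub>m n" and BA: "B * A = 1\<^sub>m n"
  shows "mat_inv A = B"
proof (cases "mat_inverse A")
  case None
  have "A \<in> Units (ring_mat TYPE(real) n ())"
    using A B AB BA by (auto simp: Units_def ring_mat_def)
  then show ?thesis using mat_inverse(1)[OF A None, of "()"] by simp
next
  case (Some C)
  have C: "C * A = 1\<^sub>m n" "C \<in> carrier_mat n n" using mat_inverse(2)[OF A Some] by auto
  have "C = C * (A * B)" using C(2) by (simp add: AB)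
  also have "\<dots> = B" using C A B by (simp add: assoc_mult_mat[symmetric, of C n n A n B n])
  finally show ?thesis using Some by (simp add: mat_inv_def)
qed

lemma mat_inv_inverse:
  assumes A: "A \<in> carrier_mat n n" and inv: "invertible_mat A"
  shows "mat_inv A \<in> carrier_mat n n" "A * mat_inv A = 1\<^sub>m n" "mat_inv A * A = 1\<^sub>m n"
proof -
  obtain B where AB: "A * B = 1\<^sub>m n" and BA: "B * A = 1\<^sub>m (dim_row B)"
    using inv A by (auto simp: invertible_mat_def inverts_mat_def)
  have "dim_row B = n" "dim_col B = n"
    using arg_cong[OF BA, of dim_col] arg_cong[OF AB, of dim_col] A by auto
  then have B: "B \<in> carrier_mat n n" by auto
  have "mat_inv A = B" using AB BA B by (intro mat_inv_eqI[OF A B]) auto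
  then show "mat_inv A \<in> carrier_mat n n" "A * mat_inv A = 1\<^sub>m n" "mat_inv A * A = 1\<^sub>m n"
    using AB BA B by auto
qed

lemma mult_mat_entry:
  assumes "A \<in> carrier_mat n m" "B \<in> carrier_mat m p" "i < n" "j < p"
  shows "(A * B) $$ (i, j) = (\<Sum>k<m. A $$ (i, k) * B $$ (k, j))"
  using assms by (simp add: scalar_prod_def lessThan_atLeast0)

lemma mult_mat_vec_entry:
  assumes "A \<in> carrier_mat n m" "dim_vec v = m" "i < n"
  shows "vec_index (A *\<^sub>v v) i = (\<Sum>k<m. A $$ (i, k) * vec_index v k)"
  using assms by (simp add: scalar_prod_def lessThan_atLeast0)

lemma mat_inv_mat_diag:
  assumes "\<And>k. c k \<noteq> 0"
  shows "mat_inv (mat_diag n c) = mat_diag n (\<lambda>k. 1 / c k)"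
  using assms by (intro mat_inv_eqI[where n = n]) simp_all

lemma mat_inv_scaled:
  fixes W :: "real Matrix.mat"
  assumes W: "W \<in> carrier_mat n n" and inv: "invertible_mat W"
    and b: "\<And>k. b k \<noteq> 0" and c: "\<And>k. c k \<noteq> 0"
  shows "mat_inv (mat_diag n b * W * mat_diag n c)
    = Matrix.mat n n (\<lambda>(k, i). mat_inv W $$ (k, i) / (c k * b i))"
proof (rule mat_inv_eqI[where n = n])
  note V = mat_inv_inverse[OF W inv]
  define P where "P = Matrix.mat n n (\<lambda>(i, l). b i * W $$ (i, l) * c l)"
  have P: "mat_diag n b * W * mat_diag n c = P"
    using W by (simp add: mat_diag_mult_left[OF W] mat_diag_mult_right[of _ n] P_def) (auto intro!: eq_matI)
  let ?Q = "Matrix.mat n n (\<lambda>(k, i). mat_inv W $$ (k, i) / (c k * b i))"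
  have PQ: "P \<in> carrier_mat n n" "?Q \<in> carrier_mat n n" by (auto simp: P_def)
  show "mat_diag n b * W * mat_diag n c \<in> carrier_mat n n" "?Q \<in> carrier_mat n n"
    using P PQ by auto
  have WV: "(\<Sum>k<n. W $$ (i, k) * mat_inv W $$ (k, j)) = (if i = j then 1 else 0)"
    and VW: "(\<Sum>k<n. mat_inv W $$ (i, k) * W $$ (k, j)) = (if i = j then 1 else 0)"
    if "i < n" "j < n" for i j
    using that mult_mat_entry[OF W V(1) that] mult_mat_entry[OF V(1) W that] V by auto
  show "mat_diag n b * W * mat_diag n c * ?Q = 1\<^sub>m n"
    unfolding P
  proof (rule eq_matI)
    fix i j assume "i < dim_row (1\<^sub>m n :: real Matrix.mat)" "j < dim_col (1\<^sub>m n :: real Matrix.mat)"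
    then have ij: "i < n" "j < n" by auto
    have "(P * ?Q) $$ (i, j) = (\<Sum>k<n. b i / b j * (W $$ (i, k) * mat_inv W $$ (k, j)))"
      unfolding mult_mat_entry[OF PQ ij] using ij b c by (intro sum.cong) (auto simp: P_def)
    also have "\<dots> = b i / b j * (if i = j then 1 else 0)"
      by (simp only: sum_distrib_left[symmetric] WV[OF ij])
    finally show "(P * ?Q) $$ (i, j) = 1\<^sub>m n $$ (i, j)" using ij b by simp
  qed (auto simp: P_def)
  show "?Q * (mat_diag n b * W * mat_diag n c) = 1\<^sub>m n"
    unfolding P
  proof (rule eq_matI)
    fix i j assume "i < dim_row (1\<^sub>m n :: real Matrix.mat)" "j < dim_col (1\<^sub>m n :: real Matrix.mat)"
    then have ij: "i < n" "j < n" by auto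
    have "(?Q * P) $$ (i, j) = (\<Sum>k<n. c j / c i * (mat_inv W $$ (i, k) * W $$ (k, j)))"
      unfolding mult_mat_entry[OF PQ(2,1) ij] using ij b c by (intro sum.cong) (auto simp: P_def)
    also have "\<dots> = c j / c i * (if i = j then 1 else 0)"
      by (simp only: sum_distrib_left[symmetric] VW[OF ij])
    finally show "(?Q * P) $$ (i, j) = 1\<^sub>m n $$ (i, j)" using ij c by simp
  qed (auto simp: P_def)
qed

text \<open>
  On the first \<open>n\<close> columns \<open>W\<^sup>-\<^sup>1 W\<close> is the identity, so the identity block has the same form as the
  second block: with \<open>C\<close> the diagonal matrix of the \<open>c\<^sub>k\<close> and \<open>w\<^sub>l\<close> the \<open>l\<close>-th column of \<open>w\<close>, column \<open>l\<close>
  of the whole block row is \<open>c\<^sub>l C\<^sup>-\<^sup>1 W\<^sup>-\<^sup>1 w\<^sub>l\<close> for every \<open>l < m\<close>.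
\<close>

lemma block_row_mult_vec:
  fixes w :: "nat \<Rightarrow> nat \<Rightarrow> real" and c h :: "nat \<Rightarrow> real" and n :: nat
  defines "W \<equiv> Matrix.mat n n (\<lambda>(i, l). w i l)"
  assumes inv: "invertible_mat W" and c: "\<And>k. c k \<noteq> 0" and m: "n \<le> m" and k: "k < n"
  shows "vec_index (four_block_mat (1\<^sub>m n)
      (mat_inv (mat_diag n c) * mat_inv W * Matrix.mat n (m - n) (\<lambda>(i, l). w i (n + l))
        * mat_diag (m - n) (\<lambda>l. c (n + l)))
      (0\<^sub>m 0 n) (0\<^sub>m 0 (m - n)) *\<^sub>v Matrix.vec m h) k
    = (\<Sum>i<n. mat_inv W $$ (k, i) * (\<Sum>l<m. w i l * c l * h l)) / c k"
proof -
  have W: "W \<in> carrier_mat n n" by (simp add: W_def)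
  note V = mat_inv_inverse[OF W inv]
  define W2 where "W2 = Matrix.mat n (m - n) (\<lambda>(i, l). w i (n + l))"
  define V' where "V' = Matrix.mat n n (\<lambda>(i, j). 1 / c i * mat_inv W $$ (i, j))"
  define X where "X = mat_inv (mat_diag n c) * mat_inv W * W2 * mat_diag (m - n) (\<lambda>l. c (n + l))"
  define F where "F = four_block_mat (1\<^sub>m n) X (0\<^sub>m 0 n) (0\<^sub>m 0 (m - n))"
  have car: "W2 \<in> carrier_mat n (m - n)" "V' \<in> carrier_mat n n" by (auto simp: W2_def V'_def)
  have X: "X = Matrix.mat n (m - n) (\<lambda>(i, l). (V' * W2) $$ (i, l) * c (n + l))"
    unfolding X_def mat_inv_mat_diag[OF c] mat_diag_mult_left[OF V(1)] V'_def[symmetric]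
    by (rule mat_diag_mult_right) (use car in auto)
  have F: "F \<in> carrier_mat n m"
    using m by (auto simp: F_def X intro!: carrier_matI)
  have entry: "F $$ (k, l) = (\<Sum>i<n. mat_inv W $$ (k, i) * w i l) * c l / c k" if l: "l < m" for l
  proof (cases "l < n")
    case True
    have "(\<Sum>i<n. mat_inv W $$ (k, i) * w i l) = (mat_inv W * W) $$ (k, l)"
      unfolding mult_mat_entry[OF V(1) W k True] using True by (intro sum.cong) (auto simp: W_def)
    also have "\<dots> = (if k = l then 1 else 0)" using V(3) k True by simp
    finally show ?thesis using True k c by (simp add: F_def X)
  next
    case False
    then have l': "l - n < m - n" "n + (l - n) = l" using l by auto
    have "F $$ (k, l) = (V' * W2) $$ (k, l - n) * c l"
      using False l l' k m by (simp add: F_def X)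
    also have "(V' * W2) $$ (k, l - n) = (\<Sum>i<n. mat_inv W $$ (k, i) * w i l / c k)"
      unfolding mult_mat_entry[OF car(2,1) k l'(1)]
      using k l' by (intro sum.cong) (auto simp: V'_def W2_def)
    finally show ?thesis by (simp flip: sum_divide_distrib)
  qed
  have "vec_index (F *\<^sub>v Matrix.vec m h) k = (\<Sum>l<m. F $$ (k, l) * h l)"
    using mult_mat_vec_entry[OF F _ k, of "Matrix.vec m h"] by simp
  also have "\<dots> = (\<Sum>l<m. \<Sum>i<n. mat_inv W $$ (k, i) * (w i l * c l * h l) / c k)"
    by (intro sum.cong refl) (simp add: entry sum_distrib_right sum_divide_distrib mult.assoc)
  also have "\<dots> = (\<Sum>i<n. \<Sum>l<m. mat_inv W $$ (k, i) * (w i l * c l * h l) / c k)"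
    by (rule sum.swap)
  also have "\<dots> = (\<Sum>i<n. mat_inv W $$ (k, i) * (\<Sum>l<m. w i l * c l * h l)) / c k"
    by (simp add: sum_distrib_left sum_divide_distrib)
  finally show ?thesis by (simp add: F_def X_def W2_def)
qed

section \<open>Expansion of the kernel translates\<close>

lemma matrix_inv_right:
  "Finite_Cartesian_Product.invertible A \<Longrightarrow> A ** matrix_inv A = Finite_Cartesian_Product.mat 1"
  unfolding Finite_Cartesian_Product.invertible_def matrix_inv_def by (rule someI2_ex) auto

lemma inner_gram:
  fixes E :: "real ^ 'd ^ ('d::finite)"
  shows "u \<bullet> ((Finite_Cartesian_Product.transpose E ** E) *v w) = (E *v u) \<bullet> (E *v w)"
  by (metis dot_lmul_matrix inner_commute matrix_vector_mul_assoc transpose_matrix_vector)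

lemma Diag_mult_vec: "(Diag G E *v u) $ i = d_vec G E $ i * u $ i"
  by (simp add: matrix_vector_mult_def Diag_def d_vec_def if_distrib[of "\<lambda>a. a * _"] cong: if_cong)

lemma Diag_invertible:
  assumes "\<forall>i. GE_mat G E $ i $ i \<noteq> 0"
  shows "Diag G E ** matrix_inv (Diag G E) = Finite_Cartesian_Product.mat 1"
proof -
  let ?B = "\<chi> i j. if i = j then 1 / d_vec G E $ i else 0"
  have nz: "d_vec G E $ i \<noteq> 0" for i using assms by (simp add: d_vec_def Diag_def)
  have "Diag G E ** ?B = Finite_Cartesian_Product.mat 1" "?B ** Diag G E = Finite_Cartesian_Product.mat 1"
    using nz assms
    by (auto simp: Finite_Cartesian_Product.vec_eq_iff matrix_matrix_mult_def Diag_def d_vec_def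
        Finite_Cartesian_Product.mat_def if_distrib[of "\<lambda>a. a * _"] cong: if_cong)
  then have "Finite_Cartesian_Product.invertible (Diag G E)" by (auto simp: Finite_Cartesian_Product.invertible_def)
  then show ?thesis by (rule matrix_inv_right)
qed

text \<open>
  \<open>Diag (Id + Diag\<^sup>-\<^sup>1 Rem) = Diag + Rem\<close>, which is the whole of \<open>G\<^sup>-\<^sup>1 E\<^sup>T E\<close>.
\<close>

lemma y_vec_eq:
  assumes "\<forall>i. GE_mat G E $ i $ i \<noteq> 0"
  shows "y_vec G E x0 xc = GE_mat G E *v (xc - x0)"
proof -
  have "Diag G E + Rem G E = GE_mat G E"
    by (simp add: Finite_Cartesian_Product.vec_eq_iff Diag_def Rem_def)
  moreover have "Diag G E ** (Finite_Cartesian_Product.mat 1 + matrix_inv (Diag G E) ** Rem G E) = Diag G E + Rem G E"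
    by (simp add: matrix_add_ldistrib matrix_mul_assoc Diag_invertible[OF assms])
  ultimately show ?thesis by (simp add: y_vec_def v_vec_def matrix_vector_mul_assoc)
qed

text \<open>
  With \<open>\<Delta> = xc - x0\<close>, \<open>z = x - x0\<close> and \<open>y = y_vec G E x0 xc\<close>, the quadratic forms agree because
  \<open>G y = A \<Delta>\<close>, which makes the mixed term \<open>G\<^sup>T z \<bullet> y = z \<bullet> A \<Delta>\<close>, and because \<open>G_tilde\<close> is the Gram
  matrix of \<open>G\<^sup>-\<^sup>1 A\<close>, so that \<open>|y|\<^sup>2 = \<Delta> \<bullet> G_tilde \<Delta>\<close>.
\<close>

lemma kernel_exponent:
  fixes G E :: "real ^ 'd ^ ('d::finite)"
  assumes G: "Finite_Cartesian_Product.invertible G"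
    and nz: "\<forall>i. GE_mat G E $ i $ i \<noteq> 0"
  defines "A \<equiv> Finite_Cartesian_Product.transpose E ** E"
  shows "2 * ((Finite_Cartesian_Product.transpose G *v (x - x0)) \<bullet> y_vec G E x0 xc)
      - (norm (y_vec G E x0 xc))\<^sup>2 - (x - x0) \<bullet> (A *v (x - x0))
    = - ((x - xc) \<bullet> (A *v (x - xc)))
      - (- ((xc - x0) \<bullet> (A *v (xc - x0))) + (xc - x0) \<bullet> (G_tilde G E *v (xc - x0)))"
proof -
  define z where "z = x - x0"
  define \<Delta> where "\<Delta> = xc - x0"
  have y: "y_vec G E x0 xc = GE_mat G E *v \<Delta>" unfolding \<Delta>_def by (rule y_vec_eq[OF nz])
  have "G ** GE_mat G E = A"
    by (simp add: GE_mat_def A_def matrix_mul_assoc matrix_inv_right[OF G])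
  then have 1: "(Finite_Cartesian_Product.transpose G *v z) \<bullet> y_vec G E x0 xc = (E *v z) \<bullet> (E *v \<Delta>)"
    by (simp add: y transpose_matrix_vector dot_lmul_matrix matrix_vector_mul_assoc A_def inner_gram)
  have "G_tilde G E = Finite_Cartesian_Product.transpose (GE_mat G E) ** GE_mat G E"
    by (simp add: G_tilde_def GE_mat_def matrix_transpose_mul matrix_mul_assoc)
  then have 2: "(norm (y_vec G E x0 xc))\<^sup>2 = \<Delta> \<bullet> (G_tilde G E *v \<Delta>)"
    by (simp add: y inner_gram power2_norm_eq_inner)
  have "x - xc = z - \<Delta>" by (simp add: z_def \<Delta>_def)
  then have 3: "(x - xc) \<bullet> (A *v (x - xc))
      = (E *v z) \<bullet> (E *v z) - 2 * ((E *v z) \<bullet> (E *v \<Delta>)) + (E *v \<Delta>) \<bullet> (E *v \<Delta>)"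
    by (simp add: A_def inner_gram matrix_vector_mult_diff_distrib inner_diff_left inner_diff_right
        inner_commute)
  show ?thesis
    unfolding 2 3 z_def[symmetric] \<Delta>_def[symmetric] 1
    by (simp add: A_def inner_gram)
qed

lemma W_D_mult:
  assumes "0 < t"
  shows "W_entry e G E x0 xs i k * D_entry e G E t k
    = mi_power (y_vec G E x0 (xs i)) (e k) * (sqrt (2 ^ mi_deg (e k)) / sqrt (t ^ mi_deg (e k) * mi_fact (e k)))"
proof -
  have "(\<chi> j. v_vec G E x0 (xs i) $ j * d_vec G E $ j) = y_vec G E x0 (xs i)"
    by (simp add: Finite_Cartesian_Product.vec_eq_iff y_vec_def Diag_mult_vec mult.commute)
  then have "mi_power (v_vec G E x0 (xs i)) (e k) * mi_power (d_vec G E) (e k)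
      = mi_power (y_vec G E x0 (xs i)) (e k)"
    by (simp add: mi_power_mult)
  then show ?thesis by (simp add: W_entry_def D_entry_def flip: mult.assoc)
qed

text \<open>
  In the product \<open>W\<^sub>i\<^sub>l D\<^sub>l H\<^sub>l\<close> all powers of \<open>2\<close> and \<open>t\<close> cancel and the square roots of \<open>l!\<close> combine to
  \<open>1 / l!\<close>, so the series is, up to the exponential weight, a product of one Hermite generating
  function for each coordinate, at the entries of \<open>y\<^sub>i\<close>.
\<close>

lemma kernel_expansion:
  fixes G E :: "real ^ 'd ^ ('d::finite)"
  assumes e: "bij e" and t: "0 < t" and G: "Finite_Cartesian_Product.invertible G"
    and nz: "\<forall>i. GE_mat G E $ i $ i \<noteq> 0" and i: "i < N"
  shows "((\<lambda>k. W_entry e G E x0 xs i k * D_entry e G E t k * H_basis G E t (e k) (x - x0))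
    has_sum (vec_index (Phi E xs N x) i / E_bar G E x0 xs N $$ (i, i))) UNIV"
proof -
  define z where "z = x - x0"
  define w where "w = Finite_Cartesian_Product.transpose G *v z"
  define y where "y = y_vec G E x0 (xs i)"
  define q where "q = z \<bullet> ((Finite_Cartesian_Product.transpose E ** E) *v z)"
  let ?p = "\<lambda>l. \<Prod>j\<in>UNIV. hermite (l $ j) (w $ j) / fact (l $ j) * (y $ j) ^ (l $ j)"
  have "((\<lambda>n. hermite n (w $ j) / fact n * (y $ j) ^ n) has_sum
      exp (2 * (w $ j) * (y $ j) - (y $ j)\<^sup>2)) UNIV" for j
    using summable_hermite_generating hermite_generating_function
    by (intro norm_summable_imp_has_sum) auto
  then have "((\<lambda>l. ?p l * exp (- q)) has_sum
      (\<Prod>j\<in>UNIV. exp (2 * (w $ j) * (y $ j) - (y $ j)\<^sup>2)) * exp (- q)) UNIV"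
    by (intro has_sum_cmult_left has_sum_prod_mi)
  also have "(\<Prod>j\<in>UNIV. exp (2 * (w $ j) * (y $ j) - (y $ j)\<^sup>2)) = exp (2 * (w \<bullet> y) - (norm y)\<^sup>2)"
    unfolding power2_norm_eq_inner inner_vec_def
    by (simp add: exp_sum[symmetric] sum_subtractf sum_distrib_left power2_eq_square mult.assoc)
  also have "exp (2 * (w \<bullet> y) - (norm y)\<^sup>2) * exp (- q)
      = vec_index (Phi E xs N x) i / E_bar G E x0 xs N $$ (i, i)"
    unfolding Phi_def E_bar_def mat_diag_def Let_def using i
      kernel_exponent[OF G nz, of x x0 "xs i"]
    by (simp add: w_def y_def q_def z_def flip: exp_add exp_diff)
  finally have sum: "((\<lambda>l. ?p l * exp (- q)) has_sum
      (vec_index (Phi E xs N x) i / E_bar G E x0 xs N $$ (i, i))) UNIV" .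
  have "?p (e k) * exp (- q)
      = W_entry e G E x0 xs i k * D_entry e G E t k * H_basis G E t (e k) (x - x0)" for k
  proof -
    let ?n = "mi_deg (e k)" and ?f = "mi_fact (e k)"
    have f: "0 < ?f" by (rule mi_fact_pos)
    have "sqrt (2 ^ ?n) / sqrt (t ^ ?n * ?f) * (sqrt (t ^ ?n) / sqrt (2 ^ ?n * ?f)) = 1 / ?f"
      using t f by (simp add: real_sqrt_mult field_simps)
    moreover have "?p (e k) = mi_power y (e k) * hermite_mi (e k) w * (1 / ?f)"
      by (simp add: mi_power_def hermite_mi_def mi_fact_def prod.distrib prod_dividef)
    moreover have "a * (u / v) * (u' / v' * h * c) = a * h * (u / v * (u' / v')) * c"
      for a u v u' v' h c :: real
      by simp
    ultimately show ?thesis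
      unfolding W_D_mult[OF t] H_basis_eq[OF t] z_def[symmetric] w_def[symmetric] q_def[symmetric]
        y_def[symmetric]
      by (simp only:)
  qed
  then have "((\<lambda>k. W_entry e G E x0 xs i k * D_entry e G E t k * H_basis G E t (e k) (x - x0))
      has_sum S) UNIV \<longleftrightarrow> ((\<lambda>l. ?p l * exp (- q)) has_sum S) UNIV" for S
    using has_sum_reindex_bij_betw[OF e, of "\<lambda>l. ?p l * exp (- q)" S] by simp
  then show ?thesis using sum by blast
qed

text \<open>
  \<open>(W\<^sub>i\<^sub>l D\<^sub>l)\<^sup>2 = a\<^sup>l / l!\<close>, where the entries of \<open>a\<close> are the squared entries of \<open>y\<^sub>i\<close> times \<open>2/t\<close>; they
  sum to \<open>(2/t) |y\<^sub>i|\<^sup>2\<close>.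
\<close>

lemma W_D_tail:
  fixes G E :: "real ^ 'd ^ ('d::finite)" and x0 :: "real ^ 'd" and i :: nat
    and xs :: "nat \<Rightarrow> real ^ 'd"
  assumes e: "bij_betw e A {l. j < mi_deg l}" and t: "0 < t"
  defines "r \<equiv> norm (y_vec G E x0 (xs i))"
  shows "(\<lambda>k. (W_entry e G E x0 xs i k * D_entry e G E t k)\<^sup>2) summable_on A"
    and "infsum (\<lambda>k. (W_entry e G E x0 xs i k * D_entry e G E t k)\<^sup>2) A
      \<le> exp (2 / t * r\<^sup>2) * (2 / t * r\<^sup>2) ^ Suc j / fact (Suc j)"
proof -
  define y where "y = y_vec G E x0 (xs i)"
  define a where "a = (\<chi> n. 2 / t * (y $ n)\<^sup>2)"
  have a: "0 \<le> a $ n" for n using t by (simp add: a_def)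
  have sum: "(\<Sum>n\<in>UNIV. a $ n) = 2 / t * r\<^sup>2"
    unfolding r_def y_def[symmetric] power2_norm_eq_inner inner_vec_def
    by (simp add: a_def power2_eq_square sum_distrib_left)
  have eq: "(W_entry e G E x0 xs i k * D_entry e G E t k)\<^sup>2 = mi_power a (e k) / mi_fact (e k)" for k
  proof -
    have "(W_entry e G E x0 xs i k * D_entry e G E t k)\<^sup>2
        = (mi_power y (e k))\<^sup>2 * (2 ^ mi_deg (e k) / (t ^ mi_deg (e k) * mi_fact (e k)))"
      unfolding W_D_mult[OF t] y_def[symmetric]
      using t mi_fact_pos[of "e k"] by (simp add: power_mult_distrib power_divide)
    also have "\<dots> = ((2 / t) ^ mi_deg (e k) * (mi_power y (e k))\<^sup>2) / mi_fact (e k)"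
      by (simp add: power_divide)
    also have "(2 / t) ^ mi_deg (e k) * (mi_power y (e k))\<^sup>2 = mi_power a (e k)"
    proof -
      have "(2 / t * (y $ n)\<^sup>2) ^ m = (2 / t) ^ m * ((y $ n) ^ m)\<^sup>2" for n m
        by (simp only: power_mult_distrib flip: power_mult) (simp add: mult.commute)
      then show ?thesis
        by (simp only: power_mi_deg mi_power_def a_def prod.distrib prod_power_distrib vec_lambda_beta)
    qed
    finally show ?thesis .
  qed
  note tail = mi_exp_tail[of a j, OF a, unfolded sum]
  show "(\<lambda>k. (W_entry e G E x0 xs i k * D_entry e G E t k)\<^sup>2) summable_on A"
    using tail(1) summable_on_reindex_bij_betw[OF e, of "\<lambda>l. mi_power a l / mi_fact l"] by (simp add: eq)
  show "infsum (\<lambda>k. (W_entry e G E x0 xs i k * D_entry e G E t k)\<^sup>2) A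
      \<le> exp (2 / t * r\<^sup>2) * (2 / t * r\<^sup>2) ^ Suc j / fact (Suc j)"
    using tail(2) infsum_reindex_bij_betw[OF e, of "\<lambda>l. mi_power a l / mi_fact l"] by (simp add: eq)
qed

section \<open>The truncation error\<close>

lemma mi_power_nonzero: "(\<And>i. a $ i \<noteq> 0) \<Longrightarrow> mi_power a l \<noteq> 0"
  by (simp add: mi_power_def)

text \<open>
  Both bases arise by applying \<open>D\<^sub>1\<^sup>-\<^sup>1 W\<^sub>1\<^sup>-\<^sup>1\<close> to expansions of the kernel translates: the stable basis
  to the full series, its truncation to the partial sums.  Only the tails survive in the difference.
\<close>

lemma delta_Psi_entry:
  fixes G E :: "real ^ 'd ^ ('d::finite)"
  assumes e: "graded_enumeration e" and t: "0 < t"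
    and G: "Finite_Cartesian_Product.invertible G"
    and nz: "\<forall>i. GE_mat G E $ i $ i \<noteq> 0"
    and W1: "invertible_mat (W1 e G E x0 xs N)"
    and M: "N \<le> M" and k: "k < N"
  shows "vec_index (delta_Psi e G E t x0 xs N M x) k
    = (\<Sum>i<N. mat_inv (W1 e G E x0 xs N) $$ (k, i)
        * (\<Sum>\<^sub>\<infinity>l\<in>{M..}. W_entry e G E x0 xs i l * D_entry e G E t l * H_basis G E t (e l) (x - x0)))
      / D_entry e G E t k"
proof -
  let ?V = "mat_inv (W1 e G E x0 xs N)"
  let ?f = "\<lambda>i l. W_entry e G E x0 xs i l * D_entry e G E t l * H_basis G E t (e l) (x - x0)"
  define b where "b i = (let \<Delta> = xs i - x0 in
       exp (- (\<Delta> \<bullet> ((Finite_Cartesian_Product.transpose E ** E) *v \<Delta>))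
            + \<Delta> \<bullet> (G_tilde G E *v \<Delta>)))" for i
  have b: "b i \<noteq> 0" for i by (simp add: b_def Let_def)
  have "d_vec G E $ i \<noteq> 0" for i using nz by (simp add: d_vec_def Diag_def)
  then have D: "D_entry e G E t l \<noteq> 0" for l
    using t mi_fact_pos[of "e l"] by (simp add: D_entry_def mi_power_nonzero)
  have car: "W1 e G E x0 xs N \<in> carrier_mat N N" by (simp add: W1_def)
  have "vec_index (Psi e G E t x0 xs N x) k
      = (\<Sum>i<N. ?V $$ (k, i) / (D_entry e G E t k * b i) * vec_index (Phi E xs N x) i)"
  proof -
    have "mat_inv (E_bar G E x0 xs N * W1 e G E x0 xs N * D1 e G E t N)
        = Matrix.mat N N (\<lambda>(k, i). ?V $$ (k, i) / (D_entry e G E t k * b i))"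
      unfolding E_bar_def D1_def b_def[symmetric] by (rule mat_inv_scaled[OF car W1 b D])
    moreover have "dim_vec (Phi E xs N x) = N" by (simp add: Phi_def)
    ultimately show ?thesis
      using k by (simp add: Psi_def mult_mat_vec_entry[of _ N N] del: index_mult_mat_vec)
  qed
  also have "\<dots> = (\<Sum>i<N. ?V $$ (k, i) * (vec_index (Phi E xs N x) i / b i)) / D_entry e G E t k"
    by (simp add: sum_divide_distrib mult_ac)
  finally have Psi: "vec_index (Psi e G E t x0 xs N x) k
      = (\<Sum>i<N. ?V $$ (k, i) * (vec_index (Phi E xs N x) i / b i)) / D_entry e G E t k" .
  have Psi_hat: "vec_index (Psi_hat e G E t x0 xs N M x) k
      = (\<Sum>i<N. ?V $$ (k, i) * (\<Sum>l<M. ?f i l)) / D_entry e G E t k"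
    using block_row_mult_vec[of N "W_entry e G E x0 xs" "D_entry e G E t" M k
        "\<lambda>l. H_basis G E t (e l) (x - x0)"] W1 D M k
    by (simp add: Psi_hat_def W1_def W2_hat_def D1_def D2_hat_def H_hat_def)
  have tail: "vec_index (Phi E xs N x) i / b i - (\<Sum>l<M. ?f i l) = infsum (?f i) {M..}" if i: "i < N" for i
  proof -
    have "(?f i has_sum (vec_index (Phi E xs N x) i / b i)) UNIV"
      using kernel_expansion[OF _ t G nz i, of e x0 xs x] e i
      by (simp add: graded_enumeration_def E_bar_def mat_diag_def b_def)
    from has_sum_Diff[OF this has_sum_finite[of "{..<M}" "?f i"]]
    have "(?f i has_sum (vec_index (Phi E xs N x) i / b i - (\<Sum>l<M. ?f i l))) (UNIV - {..<M})"
      by simp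
    moreover have "UNIV - {..<M} = {M..}" by auto
    ultimately show ?thesis by (simp add: infsumI)
  qed
  have dim: "dim_vec (Psi_hat e G E t x0 xs N M x) = N" by (simp add: Psi_hat_def)
  have "vec_index (delta_Psi e G E t x0 xs N M x) k
      = vec_index (Psi e G E t x0 xs N x) k - vec_index (Psi_hat e G E t x0 xs N M x) k"
    using k dim by (simp add: delta_Psi_def)
  also have "\<dots> = (\<Sum>i<N. ?V $$ (k, i) * (vec_index (Phi E xs N x) i / b i - (\<Sum>l<M. ?f i l)))
      / D_entry e G E t k"
    unfolding Psi Psi_hat
    by (simp only: diff_divide_distrib[symmetric] sum_subtractf[symmetric] right_diff_distrib[symmetric])
  also have "\<dots> = (\<Sum>i<N. ?V $$ (k, i) * infsum (?f i) {M..}) / D_entry e G E t k"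
    using tail by simp
  finally show ?thesis .
qed

text \<open>
  A vanishing row of the inverse would give the identity matrix a zero on its diagonal.
\<close>

lemma omega_pos:
  assumes W1: "invertible_mat (W1 e G E x0 xs N)" and k: "k < N"
  shows "0 < omega e G E x0 xs N k"
proof (rule ccontr)
  let ?V = "mat_inv (W1 e G E x0 xs N)"
  have car: "W1 e G E x0 xs N \<in> carrier_mat N N" by (simp add: W1_def)
  note V = mat_inv_inverse[OF car W1]
  assume "\<not> 0 < omega e G E x0 xs N k"
  then have "(\<Sum>i<N. (?V $$ (k, i))\<^sup>2) = 0"
    using sum_nonneg[of "{..<N}" "\<lambda>i. (?V $$ (k, i))\<^sup>2"] by (simp add: omega_def)
  then have "?V $$ (k, i) = 0" if "i < N" for i
    using that by (simp add: sum_nonneg_eq_0_iff)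
  then have "(?V * W1 e G E x0 xs N) $$ (k, k) = 0"
    unfolding mult_mat_entry[OF V(1) car k k] by simp
  then show False using V(3) k by simp
qed

text \<open>
  \<open>1 / D\<^sub>k\<^sup>2 = k! (t/2)\<^sup>|\<^sup>k\<^sup>| / d\<^sup>2\<^sup>k\<close>.  The factor \<open>(2/t)\<^sup>j\<^sup>+\<^sup>1 / (j+1)!\<close> of the exponential tails belongs
  to the first sum in \<open>const_err\<close> and to the second sum here.
\<close>

lemma const_err_eq:
  assumes t: "0 < t"
  shows "const_err e G E t x0 xs N j
    = (\<Sum>k<N. omega e G E x0 xs N k / (D_entry e G E t k)\<^sup>2)
      * (\<Sum>i<N. exp (2 / t * (norm (y_vec G E x0 (xs i)))\<^sup>2)
          * (2 / t * (norm (y_vec G E x0 (xs i)))\<^sup>2) ^ Suc j / fact (Suc j))"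
proof -
  define c where "c = (2 / t) ^ Suc j / fact (Suc j)"
  have 1: "omega e G E x0 xs N k * mi_fact (e k)
                * (t / 2) powi (int (mi_deg (e k)) - int (j + 1))
              / (mi_power (d_vec G E) (2 *s e k) * fact (j + 1))
      = omega e G E x0 xs N k / (D_entry e G E t k)\<^sup>2 * c" for k
  proof -
    have "mi_power (d_vec G E) (2 *s e k) = (mi_power (d_vec G E) (e k))\<^sup>2"
      by (simp add: mi_power_def prod_power_distrib power_mult[symmetric] mult.commute)
    moreover have "(t / 2) powi (int (mi_deg (e k)) - int (j + 1)) = (t / 2) ^ mi_deg (e k) * (2 / t) ^ Suc j"
      using t by (subst power_int_diff) (auto simp: power_int_of_nat power_divide field_simps simp del: of_nat_Suc of_nat_add)
    moreover have "(D_entry e G E t k)\<^sup>2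
        = (mi_power (d_vec G E) (e k))\<^sup>2 * 2 ^ mi_deg (e k) / (t ^ mi_deg (e k) * mi_fact (e k))"
      using t mi_fact_pos[of "e k"] by (simp add: D_entry_def power_mult_distrib power_divide)
    ultimately show ?thesis
      using t mi_fact_pos[of "e k"] by (simp add: c_def power_divide mult_ac)
  qed
  have 2: "exp (2 / t * r\<^sup>2) * (2 / t * r\<^sup>2) ^ Suc j / fact (Suc j)
      = c * (exp (2 / t * r\<^sup>2) * r ^ (2 * (j + 1)))" for r :: real
    by (simp only: c_def power_mult_distrib power_mult Suc_eq_plus1) simp
  show ?thesis
    unfolding const_err_def 1 2
    by (simp only: sum_distrib_left[symmetric] sum_distrib_right[symmetric] mult.assoc)
qed

theorem theorem4p1:
  fixes E G :: "real ^ 'd ^ ('d::finite)"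
    and t :: real
    and x0 :: "real ^ 'd"
    and xs :: "nat \<Rightarrow> real ^ 'd"
    and N :: nat
    and e :: "nat \<Rightarrow> 'd multi_index"
  assumes "N \<ge> 1"
    and "graded_enumeration e"
    and "Finite_Cartesian_Product.invertible E" and "Finite_Cartesian_Product.invertible G"
    and "0 < t" and "t < 1"
    and "\<forall>i. GE_mat G E $ i $ i \<noteq> 0"
    and "invertible_mat (W1 e G E x0 xs N)"
  shows "(\<forall>k<N. omega e G E x0 xs N k > 0)
    \<and> (\<forall>j. let M = (j + CARD('d)) choose CARD('d) in
         M \<ge> N \<longrightarrow>
         (\<forall>x. (norm2_vec (delta_Psi e G E t x0 xs N M x))\<^sup>2
            \<le> const_err e G E t x0 xs N j
               * (H_lim G E t (x - x0)
                  - (\<Sum>l | mi_deg l \<le> j. (H_basis G E t l (x - x0))\<^sup>2))))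
    \<and> (\<forall>x. (\<lambda>l. (H_basis G E t l x)\<^sup>2) summable_on UNIV
         \<and> H_lim G E t x =
             exp (- 2 * (x \<bullet> ((Finite_Cartesian_Product.transpose E ** E) *v x))
                  + 2 * t * (norm (Finite_Cartesian_Product.transpose G *v x))\<^sup>2 / (1 + t))
             / (1 - t\<^sup>2) powr (real CARD('d) / 2))"
proof -
  note e = assms(2) and t = assms(5) and t1 = assms(6) and G = assms(4) and nz = assms(7)
    and W1 = assms(8)
  have lim: "((\<lambda>l. (H_basis G E t l x)\<^sup>2) has_sum H_lim G E t x) UNIV" for x
    unfolding H_lim_def
    by (rule has_sum_infsum[OF has_sum_imp_summable[OF has_sum_H_basis_sq[OF t t1]]])
  have error: "(norm2_vec (delta_Psi e G E t x0 xs N M x))\<^sup>2 \<le> const_err e G E t x0 xs N j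
               * (H_lim G E t (x - x0) - (\<Sum>l | mi_deg l \<le> j. (H_basis G E t l (x - x0))\<^sup>2))"
    if M_def: "M = (j + CARD('d)) choose CARD('d)" and M: "N \<le> M" for j M x
  proof -
    define z where "z = x - x0"
    define V where "V = mat_inv (W1 e G E x0 xs N)"
    define R where "R = H_lim G E t z - (\<Sum>l | mi_deg l \<le> j. (H_basis G E t l z)\<^sup>2)"
    define T where "T i = (\<Sum>\<^sub>\<infinity>l\<in>{M..}. W_entry e G E x0 xs i l * D_entry e G E t l * H_basis G E t (e l) z)" for i
    define Q where "Q i = exp (2 / t * (norm (y_vec G E x0 (xs i)))\<^sup>2)
          * (2 / t * (norm (y_vec G E x0 (xs i)))\<^sup>2) ^ Suc j / fact (Suc j)" for i
    have bij: "bij e" using e by (simp add: graded_enumeration_def)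
    have e_tail: "bij_betw e {M..} {l. j < mi_deg l}"
    proof -
      have "e ` {M..} = e ` (UNIV - {..<M})" by (rule arg_cong[where f = "image e"]) auto
      also have "\<dots> = UNIV - {l. mi_deg l \<le> j}"
        using bij graded_enumeration_image[OF e, of j]
        by (simp add: image_set_diff bij_is_inj bij_is_surj M_def)
      also have "\<dots> = {l. j < mi_deg l}" by auto
      finally show ?thesis
        using bij by (auto simp: bij_betw_def intro: inj_on_subset)
    qed
    have "((\<lambda>l. (H_basis G E t l z)\<^sup>2) has_sum R) (UNIV - {l. mi_deg l \<le> j})"
      unfolding R_def by (intro has_sum_Diff lim has_sum_finite finite_mi_deg_le) auto
    moreover have "UNIV - {l :: 'd multi_index. mi_deg l \<le> j} = {l. j < mi_deg l}" by auto
    ultimately have "((\<lambda>l. (H_basis G E t l z)\<^sup>2) has_sum R) {l. j < mi_deg l}" by (simp only:)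
    then have R: "((\<lambda>k. (H_basis G E t (e k) z)\<^sup>2) has_sum R) {M..}"
      using has_sum_reindex_bij_betw[OF e_tail, of "\<lambda>l. (H_basis G E t l z)\<^sup>2" R] by simp
    have R0: "0 \<le> R" using R by (rule has_sum_nonneg) simp
    have T: "(T i)\<^sup>2 \<le> Q i * R" for i
    proof -
      have "(T i)\<^sup>2 \<le> (\<Sum>\<^sub>\<infinity>k\<in>{M..}. (W_entry e G E x0 xs i k * D_entry e G E t k)\<^sup>2)
          * (\<Sum>\<^sub>\<infinity>k\<in>{M..}. (H_basis G E t (e k) z)\<^sup>2)"
        unfolding T_def
        by (rule Cauchy_Schwarz_infsum[OF W_D_tail(1)[OF e_tail t] has_sum_imp_summable[OF R]])
      also have "\<dots> \<le> Q i * R"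
        unfolding infsumI[OF R] Q_def
        by (rule mult_right_mono[OF W_D_tail(2)[OF e_tail t] R0])
      finally show ?thesis .
    qed
    have entry: "(vec_index (delta_Psi e G E t x0 xs N M x) k)\<^sup>2
        \<le> omega e G E x0 xs N k / (D_entry e G E t k)\<^sup>2 * (sum Q {..<N} * R)" if k: "k < N" for k
    proof -
      have "(\<Sum>i<N. V $$ (k, i) * T i)\<^sup>2 \<le> (\<Sum>i<N. (V $$ (k, i))\<^sup>2) * (\<Sum>i<N. (T i)\<^sup>2)"
        by (rule Cauchy_Schwarz_ineq_sum)
      also have "(\<Sum>i<N. (V $$ (k, i))\<^sup>2) = omega e G E x0 xs N k"
        by (simp add: omega_def V_def)
      also have "omega e G E x0 xs N k * (\<Sum>i<N. (T i)\<^sup>2) \<le> omega e G E x0 xs N k * (sum Q {..<N} * R)"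
        using omega_pos[OF W1 k] T
        by (intro mult_left_mono) (auto simp: sum_distrib_right intro!: sum_mono)
      finally have "(\<Sum>i<N. V $$ (k, i) * T i)\<^sup>2 / (D_entry e G E t k)\<^sup>2
          \<le> omega e G E x0 xs N k * (sum Q {..<N} * R) / (D_entry e G E t k)\<^sup>2"
        by (rule divide_right_mono) simp
      then show ?thesis
        unfolding delta_Psi_entry[OF e t G nz W1 M k] V_def T_def z_def by (simp add: power_divide)
    qed
    have "dim_vec (delta_Psi e G E t x0 xs N M x) = N"
      by (simp add: delta_Psi_def Psi_hat_def)
    then have "(norm2_vec (delta_Psi e G E t x0 xs N M x))\<^sup>2
        = (\<Sum>k<N. (vec_index (delta_Psi e G E t x0 xs N M x) k)\<^sup>2)"
      by (simp add: norm2_vec_def sum_nonneg)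
    also have "\<dots> \<le> (\<Sum>k<N. omega e G E x0 xs N k / (D_entry e G E t k)\<^sup>2 * (sum Q {..<N} * R))"
      by (intro sum_mono entry) simp
    also have "\<dots> = const_err e G E t x0 xs N j * R"
      by (simp only: const_err_eq[OF t] Q_def[abs_def] sum_distrib_right[symmetric] mult.assoc)
    finally show ?thesis by (simp only: R_def z_def)
  qed
  have "(\<lambda>l. (H_basis G E t l x)\<^sup>2) summable_on UNIV" for x
    using lim has_sum_imp_summable by blast
  moreover have "H_lim G E t x =
             exp (- 2 * (x \<bullet> ((Finite_Cartesian_Product.transpose E ** E) *v x))
                  + 2 * t * (norm (Finite_Cartesian_Product.transpose G *v x))\<^sup>2 / (1 + t))
             / (1 - t\<^sup>2) powr (real CARD('d) / 2)" for x
    unfolding H_lim_def by (rule infsumI[OF has_sum_H_basis_sq[OF t t1]])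
  ultimately show ?thesis
    unfolding Let_def using omega_pos[OF W1] error by blast
qed

end
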